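(* Let $\mathbb{H}$ and $\mathbb{K}$ be complex Hilbert spaces, and let $A$ be a bounded linear operator on $\mathbb{H}$ and $B$ a bounded linear operator on $\mathbb{K}$. Then the equality $$w^2(A \otimes B)=\frac{1}{4}\|A^*A \otimes B^*B+AA^* \otimes BB^*\|$$ holds if and only if $$\| e^{i\theta} A \otimes B+e^{-i\theta}A^* \otimes B^*\|^2=\|e^{i\theta}A \otimes B-e^{-i\theta}A^* \otimes B^*\|^2=\|A^*A \otimes B^*B+AA^* \otimes BB^*\| \quad\text{for all } \theta \in \mathbb{R}.$$
   Context: For a bounded linear operator $T$ on a complex Hilbert space with inner product $\langle\cdot,\cdot\rangle$, the numerical radius is $w(T)=\sup\{|\langle Tx,x\rangle| : \|x\|=1\}$, $w^2(T)$ denotes $(w(T))^2$, and $\|T\|$ is the operator norm. $\mathbb{H}\otimes\mathbb{K}$ is the Hilbert space tensor product (the completion of the algebraic tensor product under the inner product determined by $\langle x\otimes y,z\otimes u\rangle=\langle x,z\rangle\langle y,u\rangle$), and $A\otimes B$ is the bounded linear operator on $\mathbb{H}\otimes\mathbb{K}$ determined by $(A\otimes B)(x\otimes y)=Ax\otimes By$. *)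

theory Defs
  imports "HOL-Analysis.Analysis"
begin

section \<open>Complex Hilbert spaces\<close>

class complex_vector = real_vector +
  fixes scaleC :: "complex \<Rightarrow> 'a \<Rightarrow> 'a" (infixr "*\<^sub>C" 75)
  assumes scaleC_add_right: "a *\<^sub>C (x + y) = a *\<^sub>C x + a *\<^sub>C y"
    and scaleC_add_left: "(a + b) *\<^sub>C x = a *\<^sub>C x + b *\<^sub>C x"
    and scaleC_scaleC: "a *\<^sub>C b *\<^sub>C x = (a * b) *\<^sub>C x"
    and scaleC_one: "1 *\<^sub>C x = x"
    and scaleR_scaleC: "r *\<^sub>R x = complex_of_real r *\<^sub>C x"

text \<open>
  The inner product is linear in its first argument. The class extends \<open>real_inner\<close>, whose axioms
  say that \<open>inner\<close>, here the real part of \<open>cinner\<close>, is positive definite and that \<open>norm x\<close> is the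
  square root of \<open>inner x x\<close>.
\<close>
class complex_inner = complex_vector + real_inner +
  fixes cinner :: "'a \<Rightarrow> 'a \<Rightarrow> complex"
  assumes cinner_commute: "cinner x y = cnj (cinner y x)"
    and cinner_add_left: "cinner (x + y) z = cinner x z + cinner y z"
    and cinner_scaleC_left: "cinner (c *\<^sub>C x) y = c * cinner x y"
    and inner_eq_Re_cinner: "inner x y = Re (cinner x y)"

class chilbert_space = complex_inner + complete_space

instantiation complex :: chilbert_space
begin
definition scaleC_complex :: "complex \<Rightarrow> complex \<Rightarrow> complex" where "scaleC_complex c x = c * x"
definition cinner_complex :: "complex \<Rightarrow> complex \<Rightarrow> complex" where "cinner_complex x y = x * cnj y"
instance
  by standard
    (auto simp: scaleC_complex_def cinner_complex_def algebra_simps inner_complex_def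
      scaleR_conv_of_real)
end

definition clinear :: "('a::complex_vector \<Rightarrow> 'b::complex_vector) \<Rightarrow> bool" where
  "clinear f \<longleftrightarrow> (\<forall>x y. f (x + y) = f x + f y) \<and> (\<forall>c x. f (c *\<^sub>C x) = c *\<^sub>C f x)"

definition bounded_clinear :: "('a::complex_inner \<Rightarrow> 'b::complex_inner) \<Rightarrow> bool" where
  "bounded_clinear f \<longleftrightarrow> clinear f \<and> (\<exists>K. \<forall>x. norm (f x) \<le> K * norm x)"

lemma scaleC_zero_left [simp]: "0 *\<^sub>C x = (0 :: 'a::complex_vector)"
  using scaleC_add_left[of 0 0 x] by simp

lemma scaleC_zero_right [simp]: "c *\<^sub>C (0 :: 'a::complex_vector) = 0"
  using scaleC_add_right[of c 0 0] by simp

lemma scaleC_minus1: "(- 1) *\<^sub>C x = - (x :: 'a::complex_vector)"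
  using scaleC_add_left[of "-1" 1 x]
  by (metis add.left_inverse add_eq_0_iff2 scaleC_one scaleC_zero_left)

lemma cinner_zero_left [simp]: "cinner 0 (y :: 'a::complex_inner) = 0"
  using cinner_add_left[of 0 0 y] by simp

lemma cinner_zero_right [simp]: "cinner (x :: 'a::complex_inner) 0 = 0"
  using cinner_commute[of x 0] by simp

lemma cinner_add_right: "cinner (x :: 'a::complex_inner) (y + z) = cinner x y + cinner x z"
  by (metis cinner_add_left cinner_commute complex_cnj_add)

lemma cinner_scaleC_right: "cinner (x :: 'a::complex_inner) (c *\<^sub>C y) = cnj c * cinner x y"
  by (metis cinner_scaleC_left cinner_commute complex_cnj_mult)

lemma cinner_minus_left: "cinner (- x :: 'a::complex_inner) y = - cinner x y"
  using cinner_scaleC_left[of "-1" x y] by (simp add: scaleC_minus1)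

lemma cinner_minus_right: "cinner (x :: 'a::complex_inner) (- y) = - cinner x y"
  using cinner_scaleC_right[of x "-1" y] by (simp add: scaleC_minus1)

lemma cinner_diff_left: "cinner (x - y :: 'a::complex_inner) z = cinner x z - cinner y z"
  using cinner_add_left[of x "- y" z] by (simp add: cinner_minus_left)

lemma cinner_diff_right: "cinner (z :: 'a::complex_inner) (x - y) = cinner z x - cinner z y"
  using cinner_add_right[of z x "- y"] by (simp add: cinner_minus_right)

lemma cinner_self: "cinner x (x :: 'a::complex_inner) = of_real ((norm x)\<^sup>2)"
proof -
  have "Im (cinner x x) = 0"
    using arg_cong[OF cinner_commute[of x x], of Im] by simp
  moreover have "Re (cinner x x) = (norm x)\<^sup>2"
    using inner_eq_Re_cinner[of x x] by (simp add: power2_norm_eq_inner)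
  ultimately show ?thesis by (simp add: complex_eq_iff)
qed

lemma norm_scaleC: "norm (c *\<^sub>C x :: 'a::complex_inner) = cmod c * norm x"
proof -
  have "complex_of_real ((norm (c *\<^sub>C x))\<^sup>2) = (c * cnj c) * of_real ((norm x)\<^sup>2)"
    by (simp only: cinner_self[symmetric] cinner_scaleC_left cinner_scaleC_right mult_ac)
  also have "\<dots> = of_real ((cmod c * norm x)\<^sup>2)"
    by (simp only: complex_norm_square[symmetric] power_mult_distrib of_real_mult of_real_power)
  finally have "(norm (c *\<^sub>C x))\<^sup>2 = (cmod c * norm x)\<^sup>2"
    using of_real_eq_iff by blast
  then show ?thesis by (simp add: power2_eq_iff_nonneg)
qed

lemma cinner_Cauchy_Schwarz: "cmod (cinner x y) \<le> norm x * norm (y :: 'a::complex_inner)"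
proof (cases "cinner x y = 0")
  case False
  define c where "c = cnj (cinner x y) / cmod (cinner x y)"
  have c: "cmod c = 1" using False by (simp add: c_def norm_divide)
  have "c * cinner x y = cmod (cinner x y)"
    using False complex_norm_square[of "cinner x y"]
    by (simp add: c_def field_simps power2_eq_square)
  then have "cmod (cinner x y) = inner (c *\<^sub>C x) y"
    by (simp add: inner_eq_Re_cinner cinner_scaleC_left)
  also have "\<dots> \<le> norm (c *\<^sub>C x) * norm y" by (rule norm_cauchy_schwarz)
  finally show ?thesis by (simp add: norm_scaleC c)
qed simp


section \<open>The algebraic tensor product\<close>

text \<open>
  A list \<open>[(x1, y1), \<dots>, (xn, yn)]\<close> stands for the formal sum of the \<open>xi \<otimes> yi\<close>. Two formal sums
  are equal in the algebraic tensor product iff every bilinear form takes the same value on both.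
\<close>

definition cbilinear :: "('a::complex_vector \<Rightarrow> 'b::complex_vector \<Rightarrow> complex) \<Rightarrow> bool" where
  "cbilinear \<beta> \<longleftrightarrow> (\<forall>y. clinear (\<lambda>x. \<beta> x y)) \<and> (\<forall>x. clinear (\<beta> x))"

definition form_sum :: "('a \<Rightarrow> 'b \<Rightarrow> complex) \<Rightarrow> ('a \<times> 'b) list \<Rightarrow> complex" where
  "form_sum \<beta> s = (\<Sum>(x, y)\<leftarrow>s. \<beta> x y)"

definition tensor_eq ::
    "('a::complex_vector \<times> 'b::complex_vector) list \<Rightarrow> ('a \<times> 'b) list \<Rightarrow> bool" where
  "tensor_eq s t \<longleftrightarrow> (\<forall>\<beta>. cbilinear \<beta> \<longrightarrow> form_sum \<beta> s = form_sum \<beta> t)"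

quotient_type (overloaded) ('a, 'b) alg_tensor =
  "('a::complex_vector \<times> 'b::complex_vector) list" / tensor_eq
  by (auto intro!: equivpI reflpI sympI transpI simp: tensor_eq_def)

lemma form_sum_simps [simp]:
  "form_sum \<beta> [] = 0"
  "form_sum \<beta> ((x, y) # s) = \<beta> x y + form_sum \<beta> s"
  "form_sum \<beta> (s @ t) = form_sum \<beta> s + form_sum \<beta> t"
  by (simp_all add: form_sum_def)

lemma cbilinearD:
  assumes "cbilinear \<beta>"
  shows "\<beta> (x + x') y = \<beta> x y + \<beta> x' y" "\<beta> (c *\<^sub>C x) y = c * \<beta> x y"
    "\<beta> x (y + y') = \<beta> x y + \<beta> x y'" "\<beta> x (c *\<^sub>C y) = c * \<beta> x y"
    "\<beta> 0 y = 0" "\<beta> x 0 = 0"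
proof -
  show *: "\<beta> (x + x') y = \<beta> x y + \<beta> x' y" "\<beta> (c *\<^sub>C x) y = c * \<beta> x y"
    "\<beta> x (y + y') = \<beta> x y + \<beta> x y'" "\<beta> x (c *\<^sub>C y) = c * \<beta> x y" for x x' y y' c
    using assms by (simp_all add: cbilinear_def clinear_def scaleC_complex_def)
  show "\<beta> 0 y = 0" "\<beta> x 0 = 0" using *(2)[of 0 0 y] *(4)[of x 0 0] by simp_all
qed

lemma form_sum_scale:
  assumes "cbilinear \<beta>"
  shows "form_sum \<beta> (map (\<lambda>(x, y). (c *\<^sub>C x, y)) s) = c * form_sum \<beta> s"
  by (induction s) (auto simp: cbilinearD[OF assms] algebra_simps)

lemma map_scale_scale:
  "map (\<lambda>(x, y). (a *\<^sub>C x, y)) (map (\<lambda>(x, y). (b *\<^sub>C x, y)) s)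
    = map (\<lambda>(x, y). ((a * b) *\<^sub>C x, y)) s"
  by (induction s) (auto simp: scaleC_scaleC)

instantiation alg_tensor :: (complex_vector, complex_vector) complex_vector
begin

lift_definition zero_alg_tensor :: "('a, 'b) alg_tensor" is "[]" .

lift_definition plus_alg_tensor ::
  "('a, 'b) alg_tensor \<Rightarrow> ('a, 'b) alg_tensor \<Rightarrow> ('a, 'b) alg_tensor" is "(@)"
  by (simp add: tensor_eq_def)

lift_definition scaleC_alg_tensor ::
  "complex \<Rightarrow> ('a, 'b) alg_tensor \<Rightarrow> ('a, 'b) alg_tensor"
  is "\<lambda>c. map (\<lambda>(x, y). (c *\<^sub>C x, y))"
  by (simp add: tensor_eq_def form_sum_scale)

definition uminus_alg_tensor :: "('a, 'b) alg_tensor \<Rightarrow> ('a, 'b) alg_tensor" where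
  "uminus_alg_tensor v = (- 1) *\<^sub>C v"

definition minus_alg_tensor ::
  "('a, 'b) alg_tensor \<Rightarrow> ('a, 'b) alg_tensor \<Rightarrow> ('a, 'b) alg_tensor" where
  "minus_alg_tensor v w = v + (- 1) *\<^sub>C w"

definition scaleR_alg_tensor :: "real \<Rightarrow> ('a, 'b) alg_tensor \<Rightarrow> ('a, 'b) alg_tensor" where
  "scaleR_alg_tensor r v = complex_of_real r *\<^sub>C v"

instance
proof
  fix u v w :: "('a, 'b) alg_tensor" and a b :: complex and r r' :: real
  show "(u + v) + w = u + (v + w)" by transfer (simp add: tensor_eq_def)
  show "u + v = v + u" by transfer (simp add: tensor_eq_def)
  show "0 + u = u" by transfer (simp add: tensor_eq_def)
  show "- u + u = 0"
    unfolding uminus_alg_tensor_def by transfer (simp add: tensor_eq_def form_sum_scale)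
  show "u - v = u + - v" by (simp add: uminus_alg_tensor_def minus_alg_tensor_def)
  show add_r: "a *\<^sub>C (u + v) = a *\<^sub>C u + a *\<^sub>C v" for a
    by transfer (simp add: tensor_eq_def)
  show add_l: "(a + b) *\<^sub>C u = a *\<^sub>C u + b *\<^sub>C u" for a b
    by transfer (simp add: tensor_eq_def form_sum_scale algebra_simps)
  show sc: "a *\<^sub>C b *\<^sub>C u = (a * b) *\<^sub>C u" for a b
    by transfer (simp only: map_scale_scale tensor_eq_def simp_thms)
  show one: "1 *\<^sub>C u = u" by transfer (simp add: tensor_eq_def form_sum_scale)
  show "r *\<^sub>R u = complex_of_real r *\<^sub>C u" by (rule scaleR_alg_tensor_def)
  show "r *\<^sub>R (u + v) = r *\<^sub>R u + r *\<^sub>R v" "(r + r') *\<^sub>R u = r *\<^sub>R u + r' *\<^sub>R u"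
    "r *\<^sub>R r' *\<^sub>R u = (r * r') *\<^sub>R u" "1 *\<^sub>R u = u"
    by (simp_all add: scaleR_alg_tensor_def add_r add_l sc one)
qed

end

text \<open>The inner product determined by \<open>\<langle>x \<otimes> y, z \<otimes> u\<rangle> = \<langle>x, z\<rangle> \<langle>y, u\<rangle>\<close>.\<close>

definition list_cinner ::
    "('a::complex_inner \<times> 'b::complex_inner) list \<Rightarrow> ('a \<times> 'b) list \<Rightarrow> complex" where
  "list_cinner s t = (\<Sum>(x, y)\<leftarrow>s. \<Sum>(z, u)\<leftarrow>t. cinner x z * cinner y u)"

lemma list_cinner_form_sum:
  "list_cinner s t = form_sum (\<lambda>x y. form_sum (\<lambda>z u. cinner x z * cinner y u) t) s"
  by (simp add: list_cinner_def form_sum_def)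

lemma list_cinner_commute: "list_cinner s t = cnj (list_cinner t s)"
proof (induction s)
  case Nil
  have "form_sum (\<lambda>x y. 0) t = 0" by (induction t) auto
  then show ?case by (simp add: list_cinner_form_sum)
next
  case (Cons p s)
  obtain x y where p: "p = (x, y)" by fastforce
  have "form_sum (\<lambda>z u. cinner x z * cinner y u) t + cnj (list_cinner t s)
      = cnj (list_cinner t ((x, y) # s))"
  proof (induction t)
    case (Cons q t)
    obtain z u where "q = (z, u)" by fastforce
    then show ?case using Cons
      by (simp add: list_cinner_form_sum algebra_simps cinner_commute[of x z] cinner_commute[of y u])
  qed (simp add: list_cinner_form_sum)
  then show ?case using Cons by (simp add: p list_cinner_form_sum)
qed

lemma cbilinear_list_cinner:
  "cbilinear (\<lambda>x y. form_sum (\<lambda>z u. cinner x z * cinner y u) t)"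
  by (induction t)
    (auto simp: cbilinear_def clinear_def scaleC_complex_def cinner_add_left cinner_scaleC_left
      algebra_simps)

lemma list_cinner_cong:
  assumes "tensor_eq s s'" "tensor_eq t t'"
  shows "list_cinner s t = list_cinner s' t'"
proof -
  have "list_cinner s t = list_cinner s' t" if "tensor_eq s s'" for s s' t
    using that cbilinear_list_cinner[of t] by (auto simp: list_cinner_form_sum tensor_eq_def)
  then show ?thesis using assms list_cinner_commute by metis
qed

text \<open>Every tensor is a sum of \<open>e \<otimes> f\<close> with orthonormal \<open>e\<close>; this gives positive definiteness.\<close>

fun orthonormal_fst :: "('a::complex_inner \<times> 'b) list \<Rightarrow> bool" where
  "orthonormal_fst [] = True"
| "orthonormal_fst ((e, f) # s) =
    (cinner e e = 1 \<and> (\<forall>(e', f')\<in>set s. cinner e e' = 0) \<and> orthonormal_fst s)"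

lemma orthonormal_fst_sum:
  assumes "orthonormal_fst s" "(e, f) \<in> set s"
  shows "(\<Sum>(z, u)\<leftarrow>s. cinner e z * g z u) = g e f"
  using assms
proof (induction s)
  case (Cons p s)
  obtain e0 f0 where p: "p = (e0, f0)" by fastforce
  have orth: "cinner e0 z = 0" "cinner z e0 = 0" if "(z, u) \<in> set s" for z u
    using Cons.prems that cinner_commute[of z e0] by (auto simp: p)
  show ?case
  proof (cases "(e, f) \<in> set s")
    case True
    then show ?thesis using Cons orth(2) by (simp add: p)
  next
    case False
    then have ef: "e = e0" "f = f0" using Cons.prems by (auto simp: p)
    have "(\<Sum>(z, u)\<leftarrow>s. cinner e0 z * g z u) = (\<Sum>_\<leftarrow>s. 0)"
      by (intro arg_cong[where f = sum_list] map_cong) (auto simp: orth(1))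
    then show ?thesis using Cons.prems by (simp add: p ef)
  qed
qed simp

lemma list_cinner_orthonormal_fst:
  assumes "orthonormal_fst s"
  shows "list_cinner s s = of_real (\<Sum>(e, f)\<leftarrow>s. (norm f)\<^sup>2)"
proof -
  have "(\<Sum>(z, u)\<leftarrow>s. cinner e z * cinner f u) = cinner f f" if "(e, f) \<in> set s" for e f
    using orthonormal_fst_sum[OF assms that, of "\<lambda>z u. cinner f u"] .
  then have "list_cinner s s = (\<Sum>(e, f)\<leftarrow>s. cinner f f)"
    unfolding list_cinner_def by (intro arg_cong[where f = sum_list] map_cong) auto
  also have "\<dots> = of_real (\<Sum>(e, f)\<leftarrow>s. (norm f)\<^sup>2)"
    by (induction s) (auto simp: cinner_self)
  finally show ?thesis .
qed

lemma exists_orthonormal_fst: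
  fixes s :: "('a::complex_inner \<times> 'b::complex_vector) list"
  shows "\<exists>t. orthonormal_fst t \<and> tensor_eq s t"
proof (induction s)
  case Nil
  then show ?case by (intro exI[of _ "[]"]) (simp add: tensor_eq_def)
next
  case (Cons q s)
  obtain x y where q: "q = (x, y)" by fastforce
  obtain t where t: "orthonormal_fst t" "tensor_eq s t" using Cons by blast
  define p where "p = (\<Sum>(e, f)\<leftarrow>t. cinner x e *\<^sub>C e)"
  define r where "r = x - p"
  define t' where "t' = map (\<lambda>(e, f). (e, f + cinner x e *\<^sub>C y)) t"
  have orth_map: "orthonormal_fst (map (\<lambda>(e, f). (e, h e f)) s)" if "orthonormal_fst s"
    for h :: "'a \<Rightarrow> 'b \<Rightarrow> 'b" and s
    using that by (induction s) auto
  have t': "orthonormal_fst t'" unfolding t'_def by (rule orth_map[OF t(1)])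
  have sum_t': "form_sum \<beta> t' = form_sum \<beta> t + \<beta> p y" if b: "cbilinear \<beta>" for \<beta>
    unfolding t'_def p_def by (induction t) (auto simp: cbilinearD[OF b] algebra_simps)
  have r_orth: "cinner r e = 0" if "(e, f) \<in> set t" for e f
  proof -
    have "cnj (cinner p e) = (\<Sum>(z, u)\<leftarrow>t. cinner e z * cnj (cinner x z))"
      unfolding p_def
      by (induction t)
        (auto simp: cinner_add_left cinner_scaleC_left algebra_simps cinner_commute[of e])
    also have "\<dots> = cnj (cinner x e)" by (rule orthonormal_fst_sum[OF t(1) that])
    finally show ?thesis by (simp add: r_def cinner_diff_left)
  qed
  show ?case
  proof (cases "r = 0")
    case True
    then have "p = x" by (simp add: r_def)
    then have "tensor_eq (q # s) t'" using t(2) sum_t' by (auto simp: tensor_eq_def q)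
    then show ?thesis using t' by blast
  next
    case False
    define e where "e = complex_of_real (1 / norm r) *\<^sub>C r"
    define f where "f = complex_of_real (norm r) *\<^sub>C y"
    have "norm e = 1" using False by (simp add: e_def norm_scaleC norm_divide)
    then have e: "cinner e e = 1" by (simp add: cinner_self)
    have "\<forall>(e', f')\<in>set t'. cinner e e' = 0"
      using r_orth by (auto simp: t'_def e_def cinner_scaleC_left)
    then have "orthonormal_fst ((e, f) # t')" using e t' by simp
    moreover have "tensor_eq (q # s) ((e, f) # t')"
      unfolding tensor_eq_def
    proof (intro allI impI)
      fix \<beta> :: "'a \<Rightarrow> 'b \<Rightarrow> complex" assume b: "cbilinear \<beta>"
      have "\<beta> x y = \<beta> (p + r) y" by (simp add: r_def)
      also have "\<dots> = \<beta> p y + \<beta> e f"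
        using False by (simp add: cbilinearD[OF b] e_def f_def)
      finally show "form_sum \<beta> (q # s) = form_sum \<beta> ((e, f) # t')"
        using t(2) b by (simp add: q sum_t'[OF b] tensor_eq_def)
    qed
    ultimately show ?thesis by blast
  qed
qed

lemma list_cinner_pos:
  "0 \<le> Re (list_cinner s s)" "list_cinner s s = 0 \<Longrightarrow> tensor_eq s []"
proof -
  obtain t where t: "orthonormal_fst t" "tensor_eq s t" using exists_orthonormal_fst by blast
  define S where "S = (\<Sum>(e, f)\<leftarrow>t. (norm f)\<^sup>2)"
  have eq: "list_cinner s s = of_real S"
    using list_cinner_orthonormal_fst[OF t(1)] list_cinner_cong[OF t(2) t(2)] by (simp add: S_def)
  have "0 \<le> S" unfolding S_def by (rule sum_list_nonneg) auto
  then show "0 \<le> Re (list_cinner s s)" by (simp add: eq)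
  assume "list_cinner s s = 0"
  then have "S = 0" using eq by simp
  then have "\<forall>(e, f)\<in>set t. f = 0"
    unfolding S_def by (subst (asm) sum_list_nonneg_eq_0_iff) auto
  then have "form_sum \<beta> t = 0" if b: "cbilinear \<beta>" for \<beta>
    by (induction t) (auto simp: cbilinearD[OF b])
  then show "tensor_eq s []" using t(2) by (simp add: tensor_eq_def)
qed

instantiation alg_tensor :: (complex_inner, complex_inner) complex_inner
begin

lift_definition cinner_alg_tensor ::
  "('a, 'b) alg_tensor \<Rightarrow> ('a, 'b) alg_tensor \<Rightarrow> complex" is list_cinner
  by (rule list_cinner_cong)

definition inner_alg_tensor :: "('a, 'b) alg_tensor \<Rightarrow> ('a, 'b) alg_tensor \<Rightarrow> real" where
  "inner_alg_tensor v w = Re (cinner v w)"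
definition norm_alg_tensor :: "('a, 'b) alg_tensor \<Rightarrow> real" where
  "norm_alg_tensor v = sqrt (inner v v)"
definition sgn_alg_tensor :: "('a, 'b) alg_tensor \<Rightarrow> ('a, 'b) alg_tensor" where
  "sgn_alg_tensor v = v /\<^sub>R norm v"
definition dist_alg_tensor :: "('a, 'b) alg_tensor \<Rightarrow> ('a, 'b) alg_tensor \<Rightarrow> real" where
  "dist_alg_tensor v w = norm (v - w)"
definition uniformity_alg_tensor ::
    "(('a, 'b) alg_tensor \<times> ('a, 'b) alg_tensor) filter" where
  "uniformity_alg_tensor = (INF e\<in>{0<..}. principal {(x, y). dist x y < e})"
definition open_alg_tensor :: "('a, 'b) alg_tensor set \<Rightarrow> bool" where
  "open_alg_tensor U = (\<forall>x\<in>U. eventually (\<lambda>(x', y). x' = x \<longrightarrow> y \<in> U) uniformity)"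

instance
proof
  fix u v w :: "('a, 'b) alg_tensor" and c :: complex and r :: real
  show comm: "cinner u v = cnj (cinner v u)" for u v :: "('a, 'b) alg_tensor"
    by transfer (rule list_cinner_commute)
  show add: "cinner (u + v) w = cinner u w + cinner v w"
    by transfer (simp add: list_cinner_form_sum)
  show sc: "cinner (c *\<^sub>C u) v = c * cinner u v" for c and u v :: "('a, 'b) alg_tensor"
    by transfer (simp add: list_cinner_form_sum form_sum_scale[OF cbilinear_list_cinner])
  show "inner u v = Re (cinner u v)" by (rule inner_alg_tensor_def)
  show "inner u v = inner v u"
    using arg_cong[OF comm[of u v], of Re] by (simp add: inner_alg_tensor_def)
  show "inner (u + v) w = inner u w + inner v w" by (simp add: inner_alg_tensor_def add)
  show "inner (r *\<^sub>R u) v = r * inner u v"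
    by (simp add: inner_alg_tensor_def scaleR_scaleC sc)
  show "0 \<le> inner u u"
    unfolding inner_alg_tensor_def by transfer (rule list_cinner_pos)
  show "(inner u u = 0) = (u = 0)"
  proof
    assume "inner u u = 0"
    moreover have "Im (cinner u u) = 0" using arg_cong[OF comm[of u u], of Im] by simp
    ultimately have "cinner u u = 0" by (simp add: inner_alg_tensor_def complex_eq_iff)
    then show "u = 0" by transfer (rule list_cinner_pos)
  next
    assume "u = 0"
    then show "inner u u = 0" using sc[of 0 u u] by (simp add: inner_alg_tensor_def)
  qed
  show "norm u = sqrt (inner u u)" by (rule norm_alg_tensor_def)
  show "sgn u = u /\<^sub>R norm u" by (rule sgn_alg_tensor_def)
  show "dist u v = norm (u - v)" by (rule dist_alg_tensor_def)
  show "(uniformity :: (('a, 'b) alg_tensor \<times> ('a, 'b) alg_tensor) filter)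
      = (INF e\<in>{0<..}. principal {(x, y). dist x y < e})" by (rule uniformity_alg_tensor_def)
  show "open U = (\<forall>x\<in>U. eventually (\<lambda>(x', y). x' = x \<longrightarrow> y \<in> U) uniformity)"
    for U :: "('a, 'b) alg_tensor set" by (rule open_alg_tensor_def)
qed

end

lift_definition alg_tensor_of ::
  "'a::complex_vector \<Rightarrow> 'b::complex_vector \<Rightarrow> ('a, 'b) alg_tensor" is "\<lambda>x y. [(x, y)]" .


section \<open>Completion of an inner product space\<close>

definition cauchy_eq :: "(nat \<Rightarrow> 'a::real_normed_vector) \<Rightarrow> (nat \<Rightarrow> 'a) \<Rightarrow> bool" where
  "cauchy_eq X Y \<longleftrightarrow> Cauchy X \<and> Cauchy Y \<and> (\<lambda>n. X n - Y n) \<longlonglongrightarrow> 0"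

lemma part_equivp_cauchy_eq: "part_equivp (cauchy_eq :: (nat \<Rightarrow> 'a::real_normed_vector) \<Rightarrow> _)"
proof (rule part_equivpI)
  show "\<exists>X::nat \<Rightarrow> 'a. cauchy_eq X X"
    by (intro exI[of _ "\<lambda>_. 0"]) (auto simp: cauchy_eq_def intro: convergent_Cauchy convergent_const)
  show "symp (cauchy_eq :: (nat \<Rightarrow> 'a) \<Rightarrow> _)"
  proof (rule sympI)
    fix X Y :: "nat \<Rightarrow> 'a" assume "cauchy_eq X Y"
    then show "cauchy_eq Y X"
      using tendsto_minus[of "\<lambda>n. X n - Y n" 0 sequentially] by (simp add: cauchy_eq_def)
  qed
  show "transp (cauchy_eq :: (nat \<Rightarrow> 'a) \<Rightarrow> _)"
  proof (rule transpI)
    fix X Y Z :: "nat \<Rightarrow> 'a" assume "cauchy_eq X Y" "cauchy_eq Y Z"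
    then show "cauchy_eq X Z"
      using tendsto_add[of "\<lambda>n. X n - Y n" 0 sequentially "\<lambda>n. Y n - Z n" 0]
      by (auto simp: cauchy_eq_def)
  qed
qed

quotient_type (overloaded) 'a completion = "nat \<Rightarrow> 'a::complex_inner" / partial: cauchy_eq
  by (rule part_equivp_cauchy_eq)

lemma Cauchy_add': "Cauchy X \<Longrightarrow> Cauchy Y \<Longrightarrow> Cauchy (\<lambda>n. X n + (Y n :: 'a::real_normed_vector))"
proof -
  assume X: "Cauchy X" and Y: "Cauchy Y"
  show ?thesis
  proof (rule metric_CauchyI)
    fix e :: real assume "0 < e"
    then have e: "0 < e / 2" by simp
    obtain M where M: "\<And>m n. m \<ge> M \<Longrightarrow> n \<ge> M \<Longrightarrow> dist (X m) (X n) < e / 2"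
      using metric_CauchyD[OF X e] by blast
    obtain N where N: "\<And>m n. m \<ge> N \<Longrightarrow> n \<ge> N \<Longrightarrow> dist (Y m) (Y n) < e / 2"
      using metric_CauchyD[OF Y e] by blast
    have "dist (X m + Y m) (X n + Y n) < e" if "m \<ge> max M N" "n \<ge> max M N" for m n
      using dist_triangle_add[of "X m" "Y m" "X n" "Y n"] M[of m n] N[of m n] that by simp
    then show "\<exists>M. \<forall>m\<ge>M. \<forall>n\<ge>M. dist (X m + Y m) (X n + Y n) < e" by blast
  qed
qed

lemma bounded_linear_scaleC: "bounded_linear (\<lambda>x::'a::complex_inner. c *\<^sub>C x)"
  by (rule bounded_linear_intro[where K = "cmod c"])
    (auto simp: scaleC_add_right scaleR_scaleC scaleC_scaleC norm_scaleC mult.commute)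

lemma bounded_bilinear_cinner:
  "bounded_bilinear (cinner :: 'a::complex_inner \<Rightarrow> 'a \<Rightarrow> complex)"
  by standard
    (auto simp: cinner_add_left cinner_add_right scaleR_scaleC cinner_scaleC_left
      cinner_scaleC_right scaleC_complex_def intro!: exI[of _ 1] cinner_Cauchy_Schwarz)

lemma Cauchy_cinner:
  fixes X Y :: "nat \<Rightarrow> 'a::complex_inner"
  assumes X: "Cauchy X" and Y: "Cauchy Y"
  shows "convergent (\<lambda>n. cinner (X n) (Y n))"
proof -
  obtain K where K: "0 < K" "\<And>n. norm (X n) \<le> K"
    using Cauchy_Bseq[OF X] by (auto simp: Bseq_def)
  obtain L where L: "0 < L" "\<And>n. norm (Y n) \<le> L"
    using Cauchy_Bseq[OF Y] by (auto simp: Bseq_def)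
  have "Cauchy (\<lambda>n. cinner (X n) (Y n))"
  proof (rule metric_CauchyI)
    fix e :: real assume e: "0 < e"
    obtain M where M: "\<And>m n. m \<ge> M \<Longrightarrow> n \<ge> M \<Longrightarrow> dist (X m) (X n) < e / (2 * L)"
      using metric_CauchyD[OF X, of "e / (2 * L)"] e L(1) by auto
    obtain N where N: "\<And>m n. m \<ge> N \<Longrightarrow> n \<ge> N \<Longrightarrow> dist (Y m) (Y n) < e / (2 * K)"
      using metric_CauchyD[OF Y, of "e / (2 * K)"] e K(1) by auto
    have "dist (cinner (X m) (Y m)) (cinner (X n) (Y n)) < e"
      if "m \<ge> max M N" "n \<ge> max M N" for m n
    proof -
      have "cinner (X m) (Y m) - cinner (X n) (Y n)
          = cinner (X m - X n) (Y m) + cinner (X n) (Y m - Y n)"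
        by (simp add: cinner_diff_left cinner_diff_right)
      then have "dist (cinner (X m) (Y m)) (cinner (X n) (Y n))
          \<le> cmod (cinner (X m - X n) (Y m)) + cmod (cinner (X n) (Y m - Y n))"
        by (simp add: dist_norm norm_triangle_ineq)
      also have "\<dots> \<le> norm (X m - X n) * L + K * norm (Y m - Y n)"
        by (intro add_mono order_trans[OF cinner_Cauchy_Schwarz] mult_mono K L) (use K in auto)
      also have "\<dots> < e / (2 * L) * L + K * (e / (2 * K))"
        using M[of m n] N[of m n] that K(1) L(1)
        by (intro add_strict_mono mult_strict_right_mono mult_strict_left_mono)
          (auto simp: dist_norm)
      also have "\<dots> = e" using K L by simp
      finally show ?thesis .
    qed
    then show "\<exists>M. \<forall>m\<ge>M. \<forall>n\<ge>M. dist (cinner (X m) (Y m)) (cinner (X n) (Y n)) < e" by blast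
  qed
  then show ?thesis by (rule Cauchy_convergent)
qed

lemma lim_cinner_cong:
  fixes X Y X' Y' :: "nat \<Rightarrow> 'a::complex_inner"
  assumes "cauchy_eq X X'" "cauchy_eq Y Y'"
  shows "lim (\<lambda>n. cinner (X n) (Y n)) = lim (\<lambda>n. cinner (X' n) (Y' n))"
proof -
  interpret bounded_bilinear "cinner :: 'a \<Rightarrow> 'a \<Rightarrow> complex" by (rule bounded_bilinear_cinner)
  have X: "Cauchy X" "Cauchy X'" "(\<lambda>n. X n - X' n) \<longlonglongrightarrow> 0"
    and Y: "Cauchy Y" "Cauchy Y'" "(\<lambda>n. Y n - Y' n) \<longlonglongrightarrow> 0"
    using assms by (auto simp: cauchy_eq_def)
  have "(\<lambda>n. cinner (X n - X' n) (Y n) + cinner (X' n) (Y n - Y' n)) \<longlonglongrightarrow> 0 + 0"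
    using Zfun_prod_Bfun[of _ sequentially Y] Bfun_prod_Zfun[of X' sequentially] X Y
    by (intro tendsto_add) (simp_all add: tendsto_Zfun_iff Cauchy_Bseq)
  then have "(\<lambda>n. cinner (X n) (Y n) - cinner (X' n) (Y' n)) \<longlonglongrightarrow> 0"
    by (simp add: cinner_diff_left cinner_diff_right)
  moreover have "(\<lambda>n. cinner (X' n) (Y' n)) \<longlonglongrightarrow> lim (\<lambda>n. cinner (X' n) (Y' n))"
    using Cauchy_cinner[OF X(2) Y(2)] by (simp add: convergent_LIMSEQ_iff)
  ultimately have "(\<lambda>n. cinner (X n) (Y n)) \<longlonglongrightarrow> lim (\<lambda>n. cinner (X' n) (Y' n))"
    using tendsto_add by fastforce
  then show ?thesis by (rule limI)
qed

lemma cauchy_eq_refl: "cauchy_eq X X \<longleftrightarrow> Cauchy X"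
  by (simp add: cauchy_eq_def)

lemma Cauchy_const: "Cauchy (\<lambda>_. x)"
  by (rule convergent_Cauchy) (rule convergent_const)

lemma Cauchy_scaleC: "Cauchy X \<Longrightarrow> Cauchy (\<lambda>n. c *\<^sub>C (X n :: 'a::complex_inner))"
  by (rule bounded_linear.Cauchy[OF bounded_linear_scaleC])

instantiation completion :: (complex_inner) complex_vector
begin

lift_definition zero_completion :: "'a completion" is "\<lambda>_. 0"
  by (simp add: cauchy_eq_refl Cauchy_const)

lift_definition plus_completion :: "'a completion \<Rightarrow> 'a completion \<Rightarrow> 'a completion"
  is "\<lambda>X Y n. X n + Y n"
  by (auto simp: cauchy_eq_def add_diff_add intro: Cauchy_add' tendsto_add_zero)

lift_definition scaleC_completion :: "complex \<Rightarrow> 'a completion \<Rightarrow> 'a completion"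
  is "\<lambda>c X n. c *\<^sub>C X n"
proof -
  fix c :: complex and X Y :: "nat \<Rightarrow> 'a" assume *: "cauchy_eq X Y"
  interpret bounded_linear "\<lambda>x::'a. c *\<^sub>C x" by (rule bounded_linear_scaleC)
  show "cauchy_eq (\<lambda>n. c *\<^sub>C X n) (\<lambda>n. c *\<^sub>C Y n)"
    using * tendsto_zero[of "\<lambda>n. X n - Y n"] by (auto simp: cauchy_eq_def diff intro: Cauchy)
qed

definition uminus_completion :: "'a completion \<Rightarrow> 'a completion" where
  "uminus_completion v = (- 1) *\<^sub>C v"
definition minus_completion :: "'a completion \<Rightarrow> 'a completion \<Rightarrow> 'a completion" where
  "minus_completion v w = v + (- 1) *\<^sub>C w"
definition scaleR_completion :: "real \<Rightarrow> 'a completion \<Rightarrow> 'a completion" where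
  "scaleR_completion r v = complex_of_real r *\<^sub>C v"

instance
proof
  fix u v w :: "'a completion" and a b :: complex and r r' :: real
  note ceq = cauchy_eq_def Cauchy_scaleC Cauchy_add' Cauchy_const
  show "(u + v) + w = u + (v + w)" by transfer (simp add: ceq add.assoc)
  show "u + v = v + u" by transfer (simp add: ceq add.commute)
  show "0 + u = u" by transfer (simp add: ceq)
  show "- u + u = 0" unfolding uminus_completion_def by transfer (simp add: ceq scaleC_minus1)
  show "u - v = u + - v" by (simp add: uminus_completion_def minus_completion_def)
  show add_r: "a *\<^sub>C (u + v) = a *\<^sub>C u + a *\<^sub>C v" for a
    by transfer (simp add: ceq scaleC_add_right)
  show add_l: "(a + b) *\<^sub>C u = a *\<^sub>C u + b *\<^sub>C u" for a b
    by transfer (simp add: ceq scaleC_add_left)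
  show scsc: "a *\<^sub>C b *\<^sub>C u = (a * b) *\<^sub>C u" for a b
    by transfer (simp add: ceq scaleC_scaleC)
  show one: "1 *\<^sub>C u = u" by transfer (simp add: ceq scaleC_one)
  show "r *\<^sub>R u = complex_of_real r *\<^sub>C u" by (rule scaleR_completion_def)
  show "r *\<^sub>R (u + v) = r *\<^sub>R u + r *\<^sub>R v" "(r + r') *\<^sub>R u = r *\<^sub>R u + r' *\<^sub>R u"
    "r *\<^sub>R r' *\<^sub>R u = (r * r') *\<^sub>R u" "1 *\<^sub>R u = u"
    by (simp_all add: scaleR_completion_def add_r add_l scsc one)
qed

end

lemma lim_cinner: "Cauchy X \<Longrightarrow> Cauchy Y \<Longrightarrow>
  (\<lambda>n. cinner (X n) (Y n :: 'a::complex_inner)) \<longlonglongrightarrow> lim (\<lambda>n. cinner (X n) (Y n))"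
  using Cauchy_cinner by (simp add: convergent_LIMSEQ_iff)

instantiation completion :: (complex_inner) complex_inner
begin

lift_definition cinner_completion :: "'a completion \<Rightarrow> 'a completion \<Rightarrow> complex"
  is "\<lambda>X Y. lim (\<lambda>n. cinner (X n) (Y n))"
  by (rule lim_cinner_cong)

definition inner_completion :: "'a completion \<Rightarrow> 'a completion \<Rightarrow> real" where
  "inner_completion v w = Re (cinner v w)"
definition norm_completion :: "'a completion \<Rightarrow> real" where
  "norm_completion v = sqrt (inner v v)"
definition sgn_completion :: "'a completion \<Rightarrow> 'a completion" where
  "sgn_completion v = v /\<^sub>R norm v"
definition dist_completion :: "'a completion \<Rightarrow> 'a completion \<Rightarrow> real" where
  "dist_completion v w = norm (v - w)"
definition uniformity_completion :: "('a completion \<times> 'a completion) filter" where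
  "uniformity_completion = (INF e\<in>{0<..}. principal {(x, y). dist x y < e})"
definition open_completion :: "'a completion set \<Rightarrow> bool" where
  "open_completion U = (\<forall>x\<in>U. eventually (\<lambda>(x', y). x' = x \<longrightarrow> y \<in> U) uniformity)"

instance
proof
  fix u v w :: "'a completion" and c :: complex and r :: real
  show comm: "cinner u v = cnj (cinner v u)" for u v :: "'a completion"
  proof transfer
    fix X Y :: "nat \<Rightarrow> 'a" assume "cauchy_eq X X" "cauchy_eq Y Y"
    then have "(\<lambda>n. cnj (cinner (Y n) (X n))) \<longlonglongrightarrow> cnj (lim (\<lambda>n. cinner (Y n) (X n)))"
      by (intro tendsto_cnj lim_cinner) (auto simp: cauchy_eq_refl)
    then show "lim (\<lambda>n. cinner (X n) (Y n)) = cnj (lim (\<lambda>n. cinner (Y n) (X n)))"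
      by (intro limI) (simp add: cinner_commute[symmetric])
  qed
  show add: "cinner (u + v) w = cinner u w + cinner v w"
    by transfer (auto simp: cauchy_eq_refl cinner_add_left intro!: limI tendsto_add lim_cinner)
  show sc: "cinner (c *\<^sub>C u) v = c * cinner u v" for c and u v :: "'a completion"
    by transfer
      (auto simp: cauchy_eq_refl cinner_scaleC_left intro!: limI tendsto_mult_left lim_cinner)
  show "inner u v = Re (cinner u v)" by (rule inner_completion_def)
  show "inner u v = inner v u"
    using arg_cong[OF comm[of u v], of Re] by (simp add: inner_completion_def)
  show "inner (u + v) w = inner u w + inner v w" by (simp add: inner_completion_def add)
  show "inner (r *\<^sub>R u) v = r * inner u v"
    by (simp add: inner_completion_def scaleR_completion_def sc)
  show "0 \<le> inner u u"
    unfolding inner_completion_def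
  proof transfer
    fix X :: "nat \<Rightarrow> 'a" assume "cauchy_eq X X"
    then have "(\<lambda>n. Re (cinner (X n) (X n))) \<longlonglongrightarrow> Re (lim (\<lambda>n. cinner (X n) (X n)))"
      by (intro tendsto_Re lim_cinner) (auto simp: cauchy_eq_refl)
    then show "0 \<le> Re (lim (\<lambda>n. cinner (X n) (X n)))"
      by (rule LIMSEQ_le_const) (auto simp: cinner_self simp del: of_real_power)
  qed
  show "(inner u u = 0) = (u = 0)"
  proof
    assume "inner u u = 0"
    then have "Re (cinner u u) = 0" by (simp add: inner_completion_def)
    then show "u = 0"
    proof transfer
      fix X :: "nat \<Rightarrow> 'a"
      assume X: "cauchy_eq X X" and 0: "Re (lim (\<lambda>n. cinner (X n) (X n))) = 0"
      have "(\<lambda>n. Re (cinner (X n) (X n))) \<longlonglongrightarrow> Re (lim (\<lambda>n. cinner (X n) (X n)))"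
        using X by (intro tendsto_Re lim_cinner) (auto simp: cauchy_eq_refl)
      then have "(\<lambda>n. (norm (X n))\<^sup>2) \<longlonglongrightarrow> 0"
        unfolding 0 by (simp add: cinner_self del: of_real_power)
      then have "(\<lambda>n. sqrt ((norm (X n))\<^sup>2)) \<longlonglongrightarrow> sqrt 0" by (rule tendsto_real_sqrt)
      then have "X \<longlonglongrightarrow> 0" by (simp add: tendsto_norm_zero_iff)
      then show "cauchy_eq X (\<lambda>_. 0)" using X by (simp add: cauchy_eq_def Cauchy_const)
    qed
  next
    assume "u = 0"
    then show "inner u u = 0" using sc[of 0 u u] by (simp add: inner_completion_def)
  qed
  show "norm u = sqrt (inner u u)" by (rule norm_completion_def)
  show "sgn u = u /\<^sub>R norm u" by (rule sgn_completion_def)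
  show "dist u v = norm (u - v)" by (rule dist_completion_def)
  show "(uniformity :: ('a completion \<times> 'a completion) filter)
      = (INF e\<in>{0<..}. principal {(x, y). dist x y < e})" by (rule uniformity_completion_def)
  show "open U = (\<forall>x\<in>U. eventually (\<lambda>(x', y). x' = x \<longrightarrow> y \<in> U) uniformity)"
    for U :: "'a completion set" by (rule open_completion_def)
qed

end

lift_definition to_completion :: "'a::complex_inner \<Rightarrow> 'a completion" is "\<lambda>x _. x"
  by (simp add: cauchy_eq_refl Cauchy_const)

lemma cinner_to_completion: "cinner (to_completion x) (to_completion y) = cinner x y"
  by transfer (simp add: limI)

lemma clinear_to_completion: "clinear to_completion"
  unfolding clinear_def by (intro conjI allI; transfer; simp add: cauchy_eq_refl Cauchy_const)

lemma to_completion_add: "to_completion (x + y) = to_completion x + to_completion y"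
  and to_completion_scaleC: "to_completion (c *\<^sub>C x) = c *\<^sub>C to_completion x"
  using clinear_to_completion unfolding clinear_def by blast+

lemma to_completion_diff: "to_completion (x - y) = to_completion x - to_completion y"
proof -
  have "to_completion (x + (-1) *\<^sub>C y) = to_completion x + (-1) *\<^sub>C to_completion y"
    by (simp only: to_completion_add to_completion_scaleC)
  then show ?thesis by (simp add: scaleC_minus1)
qed

lemma norm_to_completion: "norm (to_completion x) = norm x"
  by (simp add: norm_eq_sqrt_inner inner_eq_Re_cinner cinner_to_completion)

lemma dist_to_completion: "dist (to_completion x) (to_completion y) = dist x y"
  by (simp add: dist_norm norm_to_completion flip: to_completion_diff)

lemma norm_abs_completion:
  assumes "Cauchy X"
  shows "(\<lambda>n. norm (X n)) \<longlonglongrightarrow> norm (abs_completion X)"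
proof -
  have "(\<lambda>n. sqrt (Re (cinner (X n) (X n)))) \<longlonglongrightarrow> sqrt (Re (lim (\<lambda>n. cinner (X n) (X n))))"
    using assms by (intro tendsto_real_sqrt tendsto_Re lim_cinner)
  moreover have "lim (\<lambda>n. cinner (X n) (X n)) = cinner (abs_completion X) (abs_completion X)"
    using assms by (simp add: cinner_completion.abs_eq cauchy_eq_refl)
  ultimately show ?thesis by (simp add: norm_eq_sqrt_inner inner_eq_Re_cinner)
qed

lemma to_completion_tendsto:
  fixes X :: "nat \<Rightarrow> 'a::complex_inner"
  assumes X: "Cauchy X"
  shows "(\<lambda>n. to_completion (X n)) \<longlonglongrightarrow> abs_completion X"
proof (rule metric_LIMSEQ_I)
  fix e :: real assume e: "0 < e"
  obtain N where N: "\<And>m n. m \<ge> N \<Longrightarrow> n \<ge> N \<Longrightarrow> dist (X m) (X n) < e / 2"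
    using metric_CauchyD[OF X, of "e / 2"] e by auto
  have "dist (to_completion (X n)) (abs_completion X) < e" if n: "n \<ge> N" for n
  proof -
    have C: "Cauchy (\<lambda>m. X n + (- 1) *\<^sub>C X m)"
      using X by (intro Cauchy_add' Cauchy_scaleC Cauchy_const)
    have "to_completion (X n) - abs_completion X = to_completion (X n) + (- 1) *\<^sub>C abs_completion X"
      by (simp add: scaleC_minus1)
    also have "\<dots> = abs_completion (\<lambda>m. X n + (- 1) *\<^sub>C X m)"
      using X by (simp add: to_completion.abs_eq scaleC_completion.abs_eq plus_completion.abs_eq
        cauchy_eq_refl Cauchy_scaleC Cauchy_const)
    finally have "dist (to_completion (X n)) (abs_completion X)
        = norm (abs_completion (\<lambda>m. X n + (- 1) *\<^sub>C X m))" by (simp add: dist_norm)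
    also have "\<dots> \<le> e / 2"
      by (rule LIMSEQ_le_const2[OF norm_abs_completion[OF C]])
        (use N[OF n] in \<open>auto simp: scaleC_minus1 dist_norm intro!: exI[of _ N] less_imp_le\<close>)
    finally show ?thesis using e by simp
  qed
  then show "\<exists>N. \<forall>n\<ge>N. dist (to_completion (X n)) (abs_completion X) < e" by blast
qed

lemma abs_completion_cases:
  obtains X where "Cauchy X" "v = abs_completion X"
proof -
  have "cauchy_eq (rep_completion v) (rep_completion v)" "abs_completion (rep_completion v) = v"
    using Quotient3_completion by (auto simp: Quotient3_def)
  then show ?thesis by (intro that[of "rep_completion v"]) (auto simp: cauchy_eq_refl)
qed

lemma to_completion_dense:
  assumes "0 < e"
  shows "\<exists>x. dist (to_completion x) v < e"
proof -
  obtain X where "Cauchy X" "v = abs_completion X" by (rule abs_completion_cases)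
  then show ?thesis
    using metric_LIMSEQ_D[OF to_completion_tendsto assms, of X] by blast
qed

instance completion :: (complex_inner) chilbert_space
proof
  fix V :: "nat \<Rightarrow> 'a completion" assume V: "Cauchy V"
  have "\<exists>x. dist (to_completion x) (V n) < inverse (real (Suc n))" for n
    by (rule to_completion_dense) simp
  then obtain X where X: "\<And>n. dist (to_completion (X n)) (V n) < inverse (real (Suc n))"
    by metis
  have 0: "(\<lambda>n. to_completion (X n) - V n) \<longlonglongrightarrow> 0"
    by (rule Lim_null_comparison[OF _ LIMSEQ_inverse_real_of_nat])
      (use X in \<open>auto simp: dist_norm intro!: always_eventually less_imp_le\<close>)
  have "Cauchy (\<lambda>n. V n + (to_completion (X n) - V n))"
    by (rule Cauchy_add'[OF V LIMSEQ_imp_Cauchy[OF 0]])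
  then have "Cauchy X" by (simp add: Cauchy_def dist_to_completion)
  then have "(\<lambda>n. to_completion (X n) - (to_completion (X n) - V n)) \<longlonglongrightarrow> abs_completion X - 0"
    by (intro tendsto_diff to_completion_tendsto 0)
  then show "convergent V" by (auto simp: convergent_def)
qed


section \<open>The Hilbert space tensor product\<close>

type_synonym ('a, 'b) tensor = "('a, 'b) alg_tensor completion"

definition tensor :: "'a::complex_inner \<Rightarrow> 'b::complex_inner \<Rightarrow> ('a, 'b) tensor" (infixr "\<otimes>" 70) where
  "x \<otimes> y = to_completion (alg_tensor_of x y)"

lemma cinner_tensor: "cinner (x \<otimes> y) (z \<otimes> u) = cinner x z * cinner y u"
  unfolding tensor_def cinner_to_completion by transfer (simp add: list_cinner_def)

lemma tensor_bilinear:
  "(x + x') \<otimes> y = x \<otimes> y + x' \<otimes> y" "(c *\<^sub>C x) \<otimes> y = c *\<^sub>C (x \<otimes> y)"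
  "x \<otimes> (y + y') = x \<otimes> y + x \<otimes> y'" "x \<otimes> (c *\<^sub>C y) = c *\<^sub>C (x \<otimes> y)"
proof -
  have "alg_tensor_of (x + x') y = alg_tensor_of x y + alg_tensor_of x' y"
    "alg_tensor_of (c *\<^sub>C x) y = c *\<^sub>C alg_tensor_of x y"
    "alg_tensor_of x (y + y') = alg_tensor_of x y + alg_tensor_of x y'"
    "alg_tensor_of x (c *\<^sub>C y) = c *\<^sub>C alg_tensor_of x y"
    by (transfer; simp add: tensor_eq_def cbilinearD)+
  then show "(x + x') \<otimes> y = x \<otimes> y + x' \<otimes> y" "(c *\<^sub>C x) \<otimes> y = c *\<^sub>C (x \<otimes> y)"
    "x \<otimes> (y + y') = x \<otimes> y + x \<otimes> y'" "x \<otimes> (c *\<^sub>C y) = c *\<^sub>C (x \<otimes> y)"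
    by (simp_all add: tensor_def to_completion_add to_completion_scaleC)
qed

lemma tensor_dense:
  assumes "0 < e"
  shows "\<exists>s. dist (\<Sum>(x, y)\<leftarrow>s. x \<otimes> y) v < e"
proof -
  obtain a where a: "dist (to_completion a) v < e" using to_completion_dense[OF assms] by blast
  obtain s where s: "a = abs_alg_tensor s"
    using Quotient3_abs_rep[OF Quotient3_alg_tensor] by metis
  have "to_completion (abs_alg_tensor s) = (\<Sum>(x, y)\<leftarrow>s. x \<otimes> y)"
  proof (induction s)
    case Nil
    show ?case
      using to_completion_diff[of 0 0] by (simp flip: zero_alg_tensor.abs_eq)
  next
    case (Cons p s)
    obtain x y where p: "p = (x, y)" by fastforce
    have "abs_alg_tensor (p # s) = alg_tensor_of x y + abs_alg_tensor s"
      by (simp add: p alg_tensor_of.abs_eq plus_alg_tensor.abs_eq)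
    then show ?case
      using Cons by (simp add: p to_completion_add tensor_def)
  qed
  then show ?thesis using a s by auto
qed


section \<open>Operators\<close>

text \<open>
  For bounded \<open>T\<close>, \<open>A\<close>, \<open>B\<close> on Hilbert spaces the operators described below exist, the adjoint by the
  Riesz representation theorem, and are unique, \<open>A \<otimes>\<^sub>o B\<close> by \<open>tensor_dense\<close>.
\<close>

definition cadjoint :: "('a::complex_inner \<Rightarrow> 'b::complex_inner) \<Rightarrow> 'b \<Rightarrow> 'a" where
  "cadjoint T = (THE S. bounded_clinear S \<and> (\<forall>x y. cinner (T x) y = cinner x (S y)))"

definition tensor_op ::
    "('a::complex_inner \<Rightarrow> 'a) \<Rightarrow> ('b::complex_inner \<Rightarrow> 'b) \<Rightarrow> ('a, 'b) tensor \<Rightarrow> ('a, 'b) tensor"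
    (infixr "\<otimes>\<^sub>o" 70) where
  "A \<otimes>\<^sub>o B = (THE T. bounded_clinear T \<and> (\<forall>x y. T (x \<otimes> y) = A x \<otimes> B y))"

text \<open>
  The inserted \<open>0\<close> does not change the supremum, which is over nonnegative numbers, unless the
  space is \<open>{0}\<close>: there are then no unit vectors, and the numerical radius is to be \<open>0\<close>.
\<close>
definition numerical_radius :: "('a::complex_inner \<Rightarrow> 'a) \<Rightarrow> real" where
  "numerical_radius T = Sup (insert 0 {cmod (cinner (T x) x) |x. norm x = 1})"

end

theory Submission
  imports Defs
begin

text \<open>
  The statement is not specific to tensor products. It holds for every bounded operator \<open>T\<close> on a
  complex Hilbert space (\<open>numerical_radius_eq_iff\<close>), with \<open>N = \<parallel>T\<^sup>* T + T T\<^sup>*\<parallel>\<close>, and the claim is the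
  case \<open>T = A \<otimes> B\<close>, because \<open>(A \<otimes> B)\<^sup>* = A\<^sup>* \<otimes> B\<^sup>*\<close> (\<open>cadjoint_tensor_op\<close>) and
  \<open>(A \<otimes> B) (C \<otimes> D) = A C \<otimes> B D\<close> (\<open>tensor_op_compose\<close>).

  Put \<open>H\<^sub>\<theta> = e\<^bsup>i\<theta>\<^esup> T + e\<^bsup>-i\<theta>\<^esup> T\<^sup>*\<close>. This is self-adjoint with \<open>\<langle>H\<^sub>\<theta> x, x\<rangle> = 2 Re (e\<^bsup>i\<theta>\<^esup> \<langle>T x, x\<rangle>)\<close>. As the
  norm of a self-adjoint operator is its numerical radius, \<open>2 w(T)\<close> is the supremum of the
  \<open>\<parallel>H\<^sub>\<theta>\<parallel>\<close>. The difference \<open>e\<^bsup>i\<theta>\<^esup> T - e\<^bsup>-i\<theta>\<^esup> T\<^sup>*\<close> is \<open>-i H\<^bsub>\<theta> + \<pi>/2\<^esub>\<close>, so the condition on all \<open>\<theta>\<close> just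
  says that \<open>\<parallel>H\<^sub>\<theta>\<parallel>\<^sup>2 = N\<close> for all \<open>\<theta>\<close>, and then \<open>4 w(T)\<^sup>2 = N\<close>. Conversely, if \<open>4 w(T)\<^sup>2 = N\<close>, then no
  \<open>\<parallel>H\<^sub>\<theta>\<parallel>\<^sup>2\<close> exceeds \<open>N\<close>, while \<open>H\<^sub>\<theta>\<^sup>2 + H\<^bsub>\<theta> + \<pi>/2\<^esub>\<^sup>2 = 2 (T T\<^sup>* + T\<^sup>* T)\<close> forces
  \<open>2 N \<le> \<parallel>H\<^sub>\<theta>\<parallel>\<^sup>2 + \<parallel>H\<^bsub>\<theta> + \<pi>/2\<^esub>\<parallel>\<^sup>2\<close>; so both norms are extremal.

  Since adjoints and tensor products of operators are given by definite descriptions, their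
  existence has to be established. For adjoints it follows from the Riesz representation theorem.
  For tensor products the point is that \<open>x \<otimes> y \<mapsto> A x \<otimes> B y\<close> is bounded on the algebraic tensor
  product (\<open>list_norm2_map_prod_le\<close>), from where it extends to the completion.
\<close>

section \<open>Bounded operators and their adjoints\<close>

lemma bounded_clinearD:
  assumes "bounded_clinear T"
  shows "T (x + y) = T x + T y" "T (c *\<^sub>C x) = c *\<^sub>C T x"
    "T (x - y) = T x - T y" "T 0 = 0"
proof -
  show add: "T (x + y) = T x + T y" and scale: "T (c *\<^sub>C x) = c *\<^sub>C T x" for x y c
    using assms by (simp_all add: bounded_clinear_def clinear_def)
  show "T (x - y) = T x - T y"
    using add[of x "(- 1) *\<^sub>C y"] scale[of "- 1" y] by (simp add: scaleC_minus1)
  show "T 0 = 0" using scale[of 0 0] by simp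
qed

lemma bounded_clinear_norm_le:
  assumes "bounded_clinear T"
  obtains K where "0 \<le> K" "\<And>x. norm (T x) \<le> K * norm x"
proof -
  obtain K where K: "\<And>x. norm (T x) \<le> K * norm x"
    using assms by (auto simp: bounded_clinear_def)
  have "norm (T x) \<le> max K 0 * norm x" for x
    by (rule order_trans[OF K]) (simp add: mult_right_mono)
  then show ?thesis by (intro that[of "max K 0"]) auto
qed

lemma bounded_clinearI:
  assumes "\<And>x y. T (x + y) = T x + T y" "\<And>c x. T (c *\<^sub>C x) = c *\<^sub>C T x"
    "\<And>x. norm (T x) \<le> K * norm x"
  shows "bounded_clinear T"
  using assms unfolding bounded_clinear_def clinear_def by blast

lemma bounded_clinear_bounded_linear:
  assumes "bounded_clinear T"
  shows "bounded_linear T"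
proof -
  obtain K where "\<And>x. norm (T x) \<le> K * norm x"
    using bounded_clinear_norm_le[OF assms] by blast
  then show ?thesis
    by (intro bounded_linear_intro[where K = K])
      (auto simp: bounded_clinearD[OF assms] scaleR_scaleC mult.commute)
qed

lemma bounded_clinear_compose:
  assumes S: "bounded_clinear S" and T: "bounded_clinear T"
  shows "bounded_clinear (S \<circ> T)"
proof -
  obtain K where K: "0 \<le> K" "\<And>x. norm (S x) \<le> K * norm x"
    using bounded_clinear_norm_le[OF S] by blast
  obtain L where L: "\<And>x. norm (T x) \<le> L * norm x"
    using bounded_clinear_norm_le[OF T] by blast
  have "norm (S (T x)) \<le> (K * L) * norm x" for x
    using order_trans[OF K(2) mult_left_mono[OF L K(1)]] by (simp add: mult.assoc)
  then show ?thesis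
    by (intro bounded_clinearI[where K = "K * L"])
      (simp_all add: bounded_clinearD[OF S] bounded_clinearD[OF T])
qed

text \<open>
  The parallelogram law makes every minimizing sequence of \<open>x \<mapsto> \<parallel>x\<parallel>\<^sup>2 - 2 f x\<close> a Cauchy sequence,
  and at the minimum the derivative \<open>h \<mapsto> 2 \<langle>y, h\<rangle> - 2 f h\<close> vanishes.
\<close>
lemma riesz_representation:
  fixes f :: "'a::{real_inner, complete_space} \<Rightarrow> real"
  assumes "bounded_linear f"
  shows "\<exists>y. \<forall>x. f x = inner x y"
proof -
  interpret f: bounded_linear f by fact
  define J where "J x = inner x x - 2 * f x" for x
  define m where "m = Inf (range J)"
  obtain K where K: "\<And>x. norm (f x) \<le> norm x * K" using f.bounded by blast
  have "- (K\<^sup>2) \<le> J x" for x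
  proof -
    have "0 \<le> (norm x - K)\<^sup>2" by simp
    then show ?thesis
      using K[of x] by (simp add: J_def power2_norm_eq_inner[symmetric] power2_diff)
  qed
  then have bdd: "bdd_below (range J)" by (intro bdd_belowI) auto
  then have m: "m \<le> J x" for x unfolding m_def by (intro cInf_lower) auto
  have "\<exists>x. J x < m + inverse (real (Suc n))" for n
    using cInf_lessD[of "range J" "m + inverse (real (Suc n))"] by (auto simp: m_def)
  then obtain X where X: "\<And>n. J (X n) < m + inverse (real (Suc n))" by metis
  have parallelogram: "(norm (x - y))\<^sup>2 \<le> 2 * (J x - m) + 2 * (J y - m)" for x y
  proof -
    have "J ((1/2) *\<^sub>R (x + y)) = (J x + J y) / 2 - (norm (x - y))\<^sup>2 / 4"
      by (simp add: J_def power2_norm_eq_inner f.add f.scaleR inner_add inner_diff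
        inner_commute, simp add: inner_commute field_simps)
    then show ?thesis using m[of "(1/2) *\<^sub>R (x + y)"] by argo
  qed
  have "Cauchy X"
  proof (rule metric_CauchyI)
    fix e :: real assume e: "0 < e"
    obtain N where N: "inverse (real (Suc N)) < e\<^sup>2 / 4"
      using reals_Archimedean[of "e\<^sup>2 / 4"] e by auto
    have "dist (X i) (X j) < e" if "i \<ge> N" "j \<ge> N" for i j
    proof -
      have small: "J (X k) < m + e\<^sup>2 / 4" if "k \<ge> N" for k
      proof -
        have "inverse (real (Suc k)) \<le> inverse (real (Suc N))"
          using that by (intro le_imp_inverse_le) auto
        then show ?thesis using X[of k] N by linarith
      qed
      have "(norm (X i - X j))\<^sup>2 < e\<^sup>2"
        using parallelogram[of "X i" "X j"] small[OF that(1)] small[OF that(2)]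
        by argo
      then show ?thesis using e by (simp add: dist_norm power2_less_imp_less)
    qed
    then show "\<exists>N. \<forall>i\<ge>N. \<forall>j\<ge>N. dist (X i) (X j) < e" by blast
  qed
  then obtain y where y: "X \<longlonglongrightarrow> y" using Cauchy_convergent convergent_def by blast
  have "(\<lambda>n. J (X n)) \<longlonglongrightarrow> J y"
    unfolding J_def by (intro tendsto_intros y f.tendsto)
  moreover have "(\<lambda>n. m + inverse (real (Suc n))) \<longlonglongrightarrow> m + 0"
    by (intro tendsto_intros LIMSEQ_inverse_real_of_nat)
  ultimately have "J y \<le> m + 0"
    by (rule LIMSEQ_le) (use X in \<open>auto intro: less_imp_le\<close>)
  then have Jy: "J y = m" using m[of y] by simp
  have "f h = inner h y" for h
  proof (rule ccontr)
    assume "f h \<noteq> inner h y"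
    define d where "d = inner h y - f h"
    have d: "d \<noteq> 0" using \<open>f h \<noteq> inner h y\<close> by (simp add: d_def)
    define q where "q = 1 + inner h h"
    have q: "q \<ge> 1" by (simp add: q_def)
    \<comment> \<open>The exact minimizer of \<open>t \<mapsto> J (y + t h)\<close> is \<open>- d / \<langle>h, h\<rangle>\<close>; with \<open>1 + \<langle>h, h\<rangle>\<close> the
      denominator is visibly nonzero and \<open>J (y + t h) < J y\<close> still holds.\<close>
    define t where "t = - d / q"
    have "J (y + t *\<^sub>R h) = J y + 2 * t * d + t\<^sup>2 * inner h h"
      by (simp add: J_def d_def f.add f.scaleR inner_add inner_commute power2_eq_square
        algebra_simps)
    then have "0 \<le> 2 * t * d + t\<^sup>2 * inner h h" using m[of "y + t *\<^sub>R h"] Jy by simp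
    also have "t\<^sup>2 * inner h h \<le> t\<^sup>2 * q" by (simp add: q_def mult_left_mono)
    also have "2 * t * d + t\<^sup>2 * q = - (d\<^sup>2 / q)"
      using q by (simp add: t_def power2_eq_square field_simps)
    also have "\<dots> < 0" using q d by (simp add: divide_pos_pos)
    finally show False by simp
  qed
  then show ?thesis by blast
qed

lemma cinner_left_ext:
  assumes "\<And>x :: 'a::complex_inner. cinner x y = cinner x z"
  shows "y = z"
proof -
  have "cinner (y - z) (y - z) = 0" using assms by (simp add: cinner_diff_right)
  then show ?thesis by (simp add: cinner_self)
qed

text \<open>
  For fixed \<open>y\<close> the functional \<open>x \<mapsto> Re \<langle>T x, y\<rangle>\<close> is represented by a vector \<open>S y\<close>; replacing \<open>x\<close> by
  \<open>- \<i> x\<close> recovers the imaginary parts.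
\<close>
lemma adjoint_exists:
  fixes T :: "'a::chilbert_space \<Rightarrow> 'b::complex_inner"
  assumes T: "bounded_clinear T"
  shows "\<exists>S. bounded_clinear S \<and> (\<forall>x y. cinner (T x) y = cinner x (S y))"
proof -
  have "\<exists>s. \<forall>x. inner (T x) y = inner x s" for y
    by (intro riesz_representation bounded_linear_compose[OF bounded_linear_inner_left]
      bounded_clinear_bounded_linear T)
  then obtain S where S: "\<And>x y. inner (T x) y = inner x (S y)" by metis
  have Re: "Re (cinner (T x) y) = Re (cinner x (S y))" for x y
    using S by (simp add: inner_eq_Re_cinner)
  have adj: "cinner (T x) y = cinner x (S y)" for x y
  proof (rule complex_eqI)
    show "Im (cinner (T x) y) = Im (cinner x (S y))"
      using Re[of "(- \<i>) *\<^sub>C x" y] by (simp add: bounded_clinearD[OF T] cinner_scaleC_left)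
  qed (rule Re)
  obtain K where K: "0 \<le> K" "\<And>x. norm (T x) \<le> K * norm x"
    using bounded_clinear_norm_le[OF T] by blast
  have "bounded_clinear S"
  proof (rule bounded_clinearI)
    show "S (y + z) = S y + S z" for y z
      by (rule cinner_left_ext) (simp add: cinner_add_right flip: adj)
    show "S (c *\<^sub>C y) = c *\<^sub>C S y" for c y
      by (rule cinner_left_ext) (simp add: cinner_scaleC_right flip: adj)
    show "norm (S y) \<le> K * norm y" for y
    proof (cases "S y = 0")
      case False
      have "norm (S y) * norm (S y) = inner (T (S y)) y"
        by (simp add: S power2_norm_eq_inner flip: power2_eq_square)
      also have "\<dots> \<le> norm (T (S y)) * norm y" by (rule norm_cauchy_schwarz)
      also have "\<dots> \<le> (K * norm (S y)) * norm y" by (intro mult_right_mono K) simp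
      also have "\<dots> = (K * norm y) * norm (S y)" by simp
      finally show ?thesis using False by simp
    qed (use K in simp)
  qed
  then show ?thesis using adj by blast
qed

lemma adjoint_unique:
  assumes "bounded_clinear S" "\<And>x y. cinner (T x) y = cinner x (S y)"
  shows "cadjoint T = S"
  unfolding cadjoint_def
proof (rule the_equality)
  fix S' assume S': "bounded_clinear S' \<and> (\<forall>x y. cinner (T x) y = cinner x (S' y))"
  show "S' = S" by (rule ext, rule cinner_left_ext) (use S' assms(2) in metis)
qed (use assms in blast)

lemma
  fixes T :: "'a::chilbert_space \<Rightarrow> 'b::complex_inner"
  assumes "bounded_clinear T"
  shows bounded_clinear_cadjoint: "bounded_clinear (cadjoint T)"
    and cinner_cadjoint: "cinner (T x) y = cinner x (cadjoint T y)"
  using adjoint_exists[OF assms] adjoint_unique[of _ T] by metis+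


section \<open>The tensor product of two operators\<close>

text \<open>
  The set on which the operators agree is closed and contains the sums of simple tensors, which
  are dense. This gives the uniqueness of \<open>A \<otimes>\<^sub>o B\<close> and all identities between such operators.
\<close>
lemma bounded_clinear_tensor_ext:
  fixes S T :: "('a::complex_inner, 'b::complex_inner) tensor \<Rightarrow> 'c::complex_inner"
  assumes S: "bounded_clinear S" and T: "bounded_clinear T"
    and simple: "\<And>x y. S (x \<otimes> y) = T (x \<otimes> y)"
  shows "S = T"
proof (rule ext)
  fix v
  have "closed {v. S v = T v}"
    by (intro closed_Collect_eq linear_continuous_on bounded_clinear_bounded_linear S T)
  moreover have "(\<Sum>(x, y)\<leftarrow>s. x \<otimes> y) \<in> {v. S v = T v}" for s :: "('a \<times> 'b) list"
    by (induction s) (auto simp: bounded_clinearD[OF S] bounded_clinearD[OF T] simple)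
  then have "v \<in> closure {v. S v = T v}"
    unfolding closure_approachable using tensor_dense[of _ v] by blast
  ultimately show "S v = T v" by simp
qed

text \<open>The functionals \<open>u \<mapsto> \<langle>u, v\<rangle>\<close> and \<open>u \<mapsto> \<langle>u, w\<rangle>\<close> are bounded operators, so the previous
  lemma applies to them.\<close>
lemma tensor_vec_ext:
  fixes v w :: "('a::complex_inner, 'b::complex_inner) tensor"
  assumes "\<And>x y. cinner (x \<otimes> y) v = cinner (x \<otimes> y) w"
  shows "v = w"
proof (rule cinner_left_ext)
  have *: "bounded_clinear (\<lambda>u::('a, 'b) tensor. cinner u z)" for z
    by (rule bounded_clinearI[where K = "norm z"])
      (simp_all add: cinner_add_left cinner_scaleC_left scaleC_complex_def mult.commute
        cinner_Cauchy_Schwarz)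
  show "cinner u v = cinner u w" for u
    using bounded_clinear_tensor_ext[OF *[of v] *[of w]] assms by metis
qed

lemma form_sum_map_prod: "form_sum \<beta> (map (map_prod f g) s) = form_sum (\<lambda>x y. \<beta> (f x) (g y)) s"
  by (induction s) auto

lemma tensor_eq_map_prod:
  assumes "tensor_eq s t" "clinear A" "clinear B"
  shows "tensor_eq (map (map_prod A B) s) (map (map_prod A B) t)"
proof -
  have "cbilinear (\<lambda>x y. \<beta> (A x) (B y))" if "cbilinear \<beta>" for \<beta>
    using assms(2,3) cbilinearD[OF that]
    by (simp add: cbilinear_def clinear_def scaleC_complex_def)
  then show ?thesis using assms(1) by (simp add: tensor_eq_def form_sum_map_prod)
qed

abbreviation list_norm2 :: "('a::complex_inner \<times> 'b::complex_inner) list \<Rightarrow> real" where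
  "list_norm2 s \<equiv> Re (list_cinner s s)"

text \<open>
  With an orthonormal first component the norm of a formal sum is read off from its second
  components, so a bound on \<open>B\<close> can be applied term by term.
\<close>
lemma list_norm2_map_snd_le:
  fixes s :: "('a::complex_inner \<times> 'b::complex_inner) list"
  assumes B: "clinear B" "\<And>y. norm (B y) \<le> K * norm y"
  shows "list_norm2 (map (map_prod id B) s) \<le> K\<^sup>2 * list_norm2 s"
proof -
  obtain t where t: "orthonormal_fst t" "tensor_eq s t" using exists_orthonormal_fst by blast
  have "clinear (id :: 'a \<Rightarrow> 'a)" by (simp add: clinear_def)
  then have eq: "list_norm2 (map (map_prod id B) s) = list_norm2 (map (map_prod id B) t)"
    using tensor_eq_map_prod[OF t(2) _ B(1)] by (metis list_cinner_cong)
  have "orthonormal_fst (map (map_prod id B) t)"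
    using t(1) by (induction t) fastforce+
  then have "list_norm2 (map (map_prod id B) t) = (\<Sum>(e, f)\<leftarrow>t. (norm (B f))\<^sup>2)"
    by (simp add: list_cinner_orthonormal_fst comp_def case_prod_unfold)
  also have "\<dots> \<le> (\<Sum>(e, f)\<leftarrow>t. K\<^sup>2 * (norm f)\<^sup>2)"
    using power_mono[OF B(2), of _ 2] by (intro sum_list_mono) (auto simp: power_mult_distrib)
  also have "\<dots> = K\<^sup>2 * (\<Sum>(e, f)\<leftarrow>t. (norm f)\<^sup>2)"
    by (simp add: sum_list_const_mult case_prod_unfold)
  also have "\<dots> = K\<^sup>2 * list_norm2 t"
    using t(1) by (simp add: list_cinner_orthonormal_fst)
  also have "\<dots> = K\<^sup>2 * list_norm2 s"
    using list_cinner_cong[OF t(2) t(2)] by simp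
  finally show ?thesis by (simp add: eq)
qed

lemma list_cinner_swap:
  "list_cinner (map prod.swap s) (map prod.swap t) = list_cinner s t"
  by (simp add: list_cinner_def comp_def case_prod_unfold mult.commute)

text \<open>
  \<open>A \<otimes> B\<close> is the product of \<open>A \<otimes> 1\<close> and \<open>1 \<otimes> B\<close>, and exchanging the two factors, an isometry,
  turns the first kind into the second.
\<close>
lemma list_norm2_map_prod_le:
  fixes s :: "('a::complex_inner \<times> 'b::complex_inner) list"
  assumes A: "clinear A" "\<And>x. norm (A x) \<le> K * norm x"
    and B: "clinear B" "\<And>y. norm (B y) \<le> L * norm y"
  shows "list_norm2 (map (map_prod A B) s) \<le> K\<^sup>2 * (L\<^sup>2 * list_norm2 s)"
proof -
  have eq: "map (map_prod A B) s
      = map prod.swap (map (map_prod id A) (map prod.swap (map (map_prod id B) s)))"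
    by (simp add: comp_def map_prod_def case_prod_unfold prod.swap_def)
  have "list_norm2 (map (map_prod A B) s)
      \<le> K\<^sup>2 * list_norm2 (map prod.swap (map (map_prod id B) s))"
    unfolding eq list_cinner_swap[of "map (map_prod id A) (map prod.swap _)"]
    by (rule list_norm2_map_snd_le[OF A])
  also have "\<dots> \<le> K\<^sup>2 * (L\<^sup>2 * list_norm2 s)"
    unfolding list_cinner_swap by (intro mult_left_mono list_norm2_map_snd_le[OF B]) simp
  finally show ?thesis .
qed

lemma norm_abs_alg_tensor: "(norm (abs_alg_tensor s))\<^sup>2 = list_norm2 s"
  by (simp add: power2_norm_eq_inner inner_eq_Re_cinner cinner_alg_tensor.abs_eq)

lemma alg_tensor_op_exists:
  fixes A :: "'a::complex_inner \<Rightarrow> 'a" and B :: "'b::complex_inner \<Rightarrow> 'b"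
  assumes A: "bounded_clinear A" and B: "bounded_clinear B"
  shows "\<exists>T. bounded_clinear T \<and> (\<forall>x y. T (alg_tensor_of x y) = alg_tensor_of (A x) (B y))"
proof -
  obtain K where K: "0 \<le> K" "\<And>x. norm (A x) \<le> K * norm x"
    using bounded_clinear_norm_le[OF A] by blast
  obtain L where L: "0 \<le> L" "\<And>x. norm (B x) \<le> L * norm x"
    using bounded_clinear_norm_le[OF B] by blast
  have lin: "clinear A" "clinear B" using A B by (auto simp: bounded_clinear_def)
  define T where "T v = abs_alg_tensor (map (map_prod A B) (rep_alg_tensor v))" for v
  have rep: "\<exists>s. v = abs_alg_tensor s" for v :: "('a, 'b) alg_tensor"
    using Quotient3_abs_rep[OF Quotient3_alg_tensor] by metis
  have T: "T (abs_alg_tensor s) = abs_alg_tensor (map (map_prod A B) s)" for s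
  proof -
    have "tensor_eq (rep_alg_tensor (abs_alg_tensor s)) s"
      by (metis Quotient3_abs_rep[OF Quotient3_alg_tensor] alg_tensor.abs_eq_iff)
    then show ?thesis
      by (simp add: T_def alg_tensor.abs_eq_iff tensor_eq_map_prod lin)
  qed
  have "bounded_clinear T"
  proof (rule bounded_clinearI)
    fix v w :: "('a, 'b) alg_tensor" and c :: complex
    obtain s t where st: "v = abs_alg_tensor s" "w = abs_alg_tensor t" using rep by metis
    show "T (v + w) = T v + T w" by (simp add: st plus_alg_tensor.abs_eq T)
    have "map (map_prod A B) (map (\<lambda>(x, y). (c *\<^sub>C x, y)) s)
        = map (\<lambda>(x, y). (c *\<^sub>C x, y)) (map (map_prod A B) s)"
      by (induction s) (auto simp: bounded_clinearD[OF A])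
    then show "T (c *\<^sub>C v) = c *\<^sub>C T v" by (simp only: st scaleC_alg_tensor.abs_eq T)
    have "(norm (T v))\<^sup>2 \<le> (K * L * norm v)\<^sup>2"
      using list_norm2_map_prod_le[OF lin(1) K(2) lin(2) L(2)]
      by (simp add: st T norm_abs_alg_tensor power_mult_distrib mult.assoc)
    then show "norm (T v) \<le> K * L * norm v"
      by (rule power2_le_imp_le) (simp add: K(1) L(1))
  qed
  then show ?thesis using T by (auto simp: alg_tensor_of.abs_eq)
qed

text \<open>A bounded operator maps Cauchy sequences to Cauchy sequences and null sequences to null
  sequences, so it acts on the completion term by term.\<close>
lemma completion_extension_exists:
  fixes T :: "'a::complex_inner \<Rightarrow> 'b::complex_inner"
  assumes T: "bounded_clinear T"
  shows "\<exists>T'. bounded_clinear T' \<and> (\<forall>x. T' (to_completion x) = to_completion (T x))"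
proof -
  interpret T: bounded_linear T using T by (rule bounded_clinear_bounded_linear)
  obtain K where K: "0 \<le> K" "\<And>x. norm (T x) \<le> K * norm x"
    using bounded_clinear_norm_le[OF T] by blast
  define T' where "T' v = abs_completion (\<lambda>n. T (rep_completion v n))" for v
  have T': "T' (abs_completion X) = abs_completion (\<lambda>n. T (X n))" if X: "Cauchy X" for X
  proof -
    have "cauchy_eq (rep_completion (abs_completion X)) X"
      using X Quotient3_completion unfolding Quotient3_def by (metis cauchy_eq_refl)
    then have "cauchy_eq (\<lambda>n. T (rep_completion (abs_completion X) n)) (\<lambda>n. T (X n))"
      by (auto simp: cauchy_eq_def T.diff[symmetric] intro: T.Cauchy T.tendsto_zero)
    then show ?thesis
      unfolding T'_def by (metis Quotient3_completion Quotient3_rel_abs)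
  qed
  have "bounded_clinear T'"
  proof (rule bounded_clinearI)
    fix v w :: "'a completion" and c :: complex
    obtain X where X: "Cauchy X" "v = abs_completion X" by (rule abs_completion_cases)
    obtain Y where Y: "Cauchy Y" "w = abs_completion Y" by (rule abs_completion_cases)
    note simps = cauchy_eq_refl T' T.Cauchy Cauchy_add' Cauchy_scaleC
      plus_completion.abs_eq scaleC_completion.abs_eq
    show "T' (v + w) = T' v + T' w" using X Y by (simp add: simps T.add)
    show "T' (c *\<^sub>C v) = c *\<^sub>C T' v" using X by (simp add: simps bounded_clinearD[OF T])
    show "norm (T' v) \<le> K * norm v"
      unfolding X(2) T'[OF X(1)]
      by (rule LIMSEQ_le[OF norm_abs_completion[OF T.Cauchy[OF X(1)]]
        tendsto_mult_left[OF norm_abs_completion[OF X(1)]]]) (use K in blast)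
  qed
  then show ?thesis
    by (intro exI[of _ T']) (simp add: to_completion.abs_eq T' Cauchy_const)
qed

lemma tensor_op_unique:
  assumes "bounded_clinear T" "\<And>x y. T (x \<otimes> y) = A x \<otimes> B y"
  shows "A \<otimes>\<^sub>o B = T"
  unfolding tensor_op_def
proof (rule the_equality)
  fix T' assume "bounded_clinear T' \<and> (\<forall>x y. T' (x \<otimes> y) = A x \<otimes> B y)"
  then show "T' = T" by (intro bounded_clinear_tensor_ext) (simp_all add: assms)
qed (use assms in blast)

lemma
  assumes A: "bounded_clinear A" and B: "bounded_clinear B"
  shows bounded_clinear_tensor_op: "bounded_clinear (A \<otimes>\<^sub>o B)"
    and tensor_op_tensor: "(A \<otimes>\<^sub>o B) (x \<otimes> y) = A x \<otimes> B y"
proof -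
  obtain T0 where T0: "bounded_clinear T0"
      "\<And>x y. T0 (alg_tensor_of x y) = alg_tensor_of (A x) (B y)"
    using alg_tensor_op_exists[OF A B] by blast
  obtain T where T: "bounded_clinear T" "\<And>v. T (to_completion v) = to_completion (T0 v)"
    using completion_extension_exists[OF T0(1)] by blast
  have simple: "T (x \<otimes> y) = A x \<otimes> B y" for x y by (simp add: tensor_def T(2) T0(2))
  have "A \<otimes>\<^sub>o B = T" using T(1) simple by (rule tensor_op_unique)
  then show "bounded_clinear (A \<otimes>\<^sub>o B)" "(A \<otimes>\<^sub>o B) (x \<otimes> y) = A x \<otimes> B y"
    using T(1) simple by simp_all
qed

lemma tensor_op_compose:
  assumes "bounded_clinear A" "bounded_clinear B" "bounded_clinear C" "bounded_clinear D"
  shows "(A \<circ> C) \<otimes>\<^sub>o (B \<circ> D) = (A \<otimes>\<^sub>o B) \<circ> (C \<otimes>\<^sub>o D)"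
  by (rule tensor_op_unique)
    (simp_all add: bounded_clinear_compose bounded_clinear_tensor_op tensor_op_tensor assms)

lemma cadjoint_tensor_op:
  fixes A :: "'a::chilbert_space \<Rightarrow> 'a" and B :: "'b::chilbert_space \<Rightarrow> 'b"
  assumes A: "bounded_clinear A" and B: "bounded_clinear B"
  shows "cadjoint A \<otimes>\<^sub>o cadjoint B = cadjoint (A \<otimes>\<^sub>o B)"
proof (rule tensor_op_unique)
  note AB = bounded_clinear_tensor_op[OF A B]
  show "bounded_clinear (cadjoint (A \<otimes>\<^sub>o B))" by (rule bounded_clinear_cadjoint[OF AB])
  show "cadjoint (A \<otimes>\<^sub>o B) (x \<otimes> y) = cadjoint A x \<otimes> cadjoint B y" for x y
    by (rule tensor_vec_ext)
      (simp add: cinner_cadjoint[OF AB, symmetric] tensor_op_tensor[OF A B] cinner_tensor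
        cinner_cadjoint[OF A, symmetric] cinner_cadjoint[OF B, symmetric])
qed

section \<open>Self-adjoint operators and the numerical radius\<close>

lemma parallelogram_law:
  "(norm (x + y))\<^sup>2 + (norm (x - y))\<^sup>2 = 2 * ((norm x)\<^sup>2 + (norm (y :: 'a::real_inner))\<^sup>2)"
  by (simp add: power2_norm_eq_inner inner_add inner_diff inner_commute)

text \<open>
  Polarization expresses \<open>4 \<langle>H x, y\<rangle>\<close> through the quadratic form at \<open>x + y\<close> and \<open>x - y\<close>, and the
  parallelogram law then bounds it by \<open>2 c (\<parallel>x\<parallel>\<^sup>2 + \<parallel>y\<parallel>\<^sup>2)\<close>; taking for \<open>y\<close> the multiple of \<open>H x\<close> of
  length \<open>\<parallel>x\<parallel>\<close> gives the norm bound.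
\<close>
lemma onorm_symmetric_le:
  fixes H :: "'a::real_inner \<Rightarrow> 'a"
  assumes H: "bounded_linear H" and sym: "\<And>x y. inner (H x) y = inner x (H y)"
    and c: "0 \<le> c" "\<And>x. \<bar>inner (H x) x\<bar> \<le> c * (norm x)\<^sup>2"
  shows "onorm H \<le> c"
proof (rule onorm_bound[OF c(1)])
  interpret bounded_linear H by fact
  fix x
  show "norm (H x) \<le> c * norm x"
  proof (cases "H x = 0")
    case False
    then have x: "norm x > 0" using zero by auto
    define y where "y = (norm x / norm (H x)) *\<^sub>R H x"
    have y: "norm y = norm x" using False by (simp add: y_def)
    have "4 * inner (H x) y = inner (H (x + y)) (x + y) - inner (H (x - y)) (x - y)"
      using sym[of y x] by (simp add: add diff inner_add inner_diff inner_commute)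
    also have "\<dots> \<le> c * (norm (x + y))\<^sup>2 + c * (norm (x - y))\<^sup>2"
      using c(2)[of "x + y"] c(2)[of "x - y"] by linarith
    also have "\<dots> = c * (4 * (norm x)\<^sup>2)"
      using y parallelogram_law[of x y] by (simp flip: distrib_left)
    finally have "inner (H x) y \<le> c * (norm x)\<^sup>2" by simp
    moreover have "inner (H x) y = norm x * norm (H x)"
      using False by (simp add: y_def power2_norm_eq_inner[symmetric] power2_eq_square)
    ultimately have "norm x * norm (H x) \<le> norm x * (c * norm x)"
      by (simp add: power2_eq_square mult.left_commute)
    then show ?thesis using x by simp
  qed (use c(1) in simp)
qed

lemma numerical_radius_nonneg_bound:
  fixes T :: "'a::complex_inner \<Rightarrow> 'a"
  assumes T: "bounded_clinear T"
  shows "0 \<le> numerical_radius T"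
    and "cmod (cinner (T x) x) \<le> numerical_radius T * (norm x)\<^sup>2"
proof -
  obtain K where K: "0 \<le> K" "\<And>x. norm (T x) \<le> K * norm x"
    using bounded_clinear_norm_le[OF T] by blast
  have "cmod (cinner (T x) x) \<le> K" if "norm x = 1" for x
    using cinner_Cauchy_Schwarz[of "T x" x] K(2)[of x] that by simp
  then have bdd: "bdd_above (insert 0 {cmod (cinner (T x) x) |x. norm x = 1})"
    by (intro bdd_aboveI[of _ K]) (use K in auto)
  show "0 \<le> numerical_radius T"
    unfolding numerical_radius_def by (rule cSup_upper[OF _ bdd]) simp
  have unit: "cmod (cinner (T u) u) \<le> numerical_radius T" if "norm u = 1" for u
    unfolding numerical_radius_def by (rule cSup_upper[OF _ bdd]) (use that in blast)
  show "cmod (cinner (T x) x) \<le> numerical_radius T * (norm x)\<^sup>2"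
  proof (cases "x = 0")
    case False
    define u where "u = complex_of_real (1 / norm x) *\<^sub>C x"
    have u: "norm u = 1" using False by (simp add: u_def norm_scaleC norm_divide)
    have x: "x = complex_of_real (norm x) *\<^sub>C u"
      using False by (simp add: u_def scaleC_scaleC scaleC_one)
    have "cinner (T x) x = of_real ((norm x)\<^sup>2) * cinner (T u) u"
      by (subst (1 2) x) (simp add: bounded_clinearD[OF T] cinner_scaleC_left
        cinner_scaleC_right power2_eq_square)
    then show ?thesis
      using mult_right_mono[OF unit[OF u], of "(norm x)\<^sup>2"]
      by (simp add: norm_mult norm_power mult.commute)
  qed simp
qed

lemma numerical_radius_le:
  assumes "0 \<le> c" "\<And>x. norm x = 1 \<Longrightarrow> cmod (cinner (T x) x) \<le> c"
  shows "numerical_radius T \<le> c"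
  unfolding numerical_radius_def by (rule cSup_least) (use assms in auto)

text \<open>Twice the real part of the rotated operator \<open>e\<^bsup>i\<theta>\<^esup> T\<close>.\<close>
definition rotated_re :: "('a::complex_inner \<Rightarrow> 'a) \<Rightarrow> real \<Rightarrow> 'a \<Rightarrow> 'a" where
  "rotated_re T \<theta> v = exp (\<i> * \<theta>) *\<^sub>C T v + exp (- \<i> * \<theta>) *\<^sub>C cadjoint T v"

context
  fixes T :: "'a::chilbert_space \<Rightarrow> 'a"
  assumes T: "bounded_clinear T"
begin

lemma cinner_cadjoint': "cinner (cadjoint T x) y = cinner x (T y)"
  using cinner_cadjoint[OF T, of y x] by (metis cinner_commute)

lemma bounded_linear_rotated_re: "bounded_linear (rotated_re T \<theta>)"
  unfolding rotated_re_def
  by (intro bounded_linear_add bounded_linear_compose[OF bounded_linear_scaleC]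
    bounded_clinear_bounded_linear bounded_clinear_cadjoint T)

lemma inner_rotated_re: "inner (rotated_re T \<theta> x) x = 2 * Re (exp (\<i> * \<theta>) * cinner (T x) x)"
proof -
  have "exp (- \<i> * \<theta>) * cinner (cadjoint T x) x = cnj (exp (\<i> * \<theta>) * cinner (T x) x)"
    by (simp add: cinner_cadjoint' exp_cnj cinner_commute[of x])
  then show ?thesis
    by (simp add: inner_eq_Re_cinner rotated_re_def cinner_add_left cinner_scaleC_left)
qed

lemma rotated_re_symmetric: "inner (rotated_re T \<theta> x) y = inner x (rotated_re T \<theta> y)"
  by (simp add: inner_eq_Re_cinner rotated_re_def cinner_add_left cinner_add_right
    cinner_scaleC_left cinner_scaleC_right cinner_cadjoint[OF T] cinner_cadjoint' exp_cnj)

text \<open>The next two lemmas together say that \<open>2 w(T)\<close> is the supremum of the norms of the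
  \<open>rotated_re T \<theta>\<close>.\<close>
lemma onorm_rotated_re_le: "onorm (rotated_re T \<theta>) \<le> 2 * numerical_radius T"
proof (rule onorm_symmetric_le[OF bounded_linear_rotated_re rotated_re_symmetric])
  show "0 \<le> 2 * numerical_radius T" using numerical_radius_nonneg_bound[OF T] by simp
  fix x
  have "\<bar>inner (rotated_re T \<theta> x) x\<bar> \<le> 2 * cmod (exp (\<i> * \<theta>) * cinner (T x) x)"
    using abs_Re_le_cmod[of "exp (\<i> * \<theta>) * cinner (T x) x"] by (simp add: inner_rotated_re)
  also have "\<dots> = 2 * cmod (cinner (T x) x)" by (simp add: norm_mult)
  finally show "\<bar>inner (rotated_re T \<theta> x) x\<bar> \<le> 2 * numerical_radius T * (norm x)\<^sup>2"
    using numerical_radius_nonneg_bound(2)[OF T, of x] by simp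
qed

lemma numerical_radius_le_onorm_rotated_re:
  assumes "\<And>\<theta>. onorm (rotated_re T \<theta>) \<le> c"
  shows "2 * numerical_radius T \<le> c"
proof -
  have c: "0 \<le> c"
    using onorm_pos_le[OF bounded_linear_rotated_re] assms order_trans by blast
  have "cmod (cinner (T x) x) \<le> c / 2" if x: "norm x = 1" for x
  proof -
    define z where "z = cinner (T x) x"
    \<comment> \<open>This rotation makes \<open>\<langle>T x, x\<rangle>\<close> real and nonnegative.\<close>
    define \<theta> where "\<theta> = - Arg z"
    have "exp (\<i> * \<theta>) * z = exp (\<i> * \<theta>) * (cmod z * exp (\<i> * Arg z))"
      by (cases "z = 0") (simp_all flip: Arg_eq)
    also have "\<dots> = cmod z" by (simp add: \<theta>_def flip: exp_add)
    finally have "2 * cmod z = inner (rotated_re T \<theta> x) x"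
      by (simp add: inner_rotated_re z_def)
    also have "\<dots> \<le> norm (rotated_re T \<theta> x) * norm x" by (rule norm_cauchy_schwarz)
    also have "\<dots> \<le> onorm (rotated_re T \<theta>)"
      using onorm[OF bounded_linear_rotated_re, of \<theta> x] x by simp
    finally show ?thesis using assms[of \<theta>] by (simp add: z_def)
  qed
  then have "numerical_radius T \<le> c / 2" using c by (intro numerical_radius_le) auto
  then show ?thesis by simp
qed

lemma rotated_diff_eq:
  "exp (\<i> * \<theta>) *\<^sub>C T v - exp (- \<i> * \<theta>) *\<^sub>C cadjoint T v
    = (- \<i>) *\<^sub>C rotated_re T (\<theta> + pi / 2) v"
proof -
  have "exp (\<i> * complex_of_real (\<theta> + pi / 2)) = exp (\<i> * \<theta>) * exp (\<i> * complex_of_real (pi / 2))"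
    by (simp add: distrib_left flip: exp_add)
  moreover have "exp (- \<i> * complex_of_real (\<theta> + pi / 2))
      = exp (- \<i> * \<theta>) * exp (- \<i> * complex_of_real (pi / 2))"
    by (simp add: algebra_simps flip: exp_add)
  moreover have "exp (\<i> * complex_of_real (pi / 2)) = \<i>"
    using cis_conv_exp[of "pi / 2"] by (simp add: cis.ctr complex_eq_iff)
  moreover have "exp (- \<i> * complex_of_real (pi / 2)) = - \<i>"
    using cis_conv_exp[of "- pi / 2"] by (simp add: cis.ctr complex_eq_iff)
  moreover have "\<i> * (a * \<i>) = - a" for a
    by (simp add: complex_eq_iff)
  ultimately have "(- \<i>) *\<^sub>C rotated_re T (\<theta> + pi / 2) v
      = exp (\<i> * \<theta>) *\<^sub>C T v + (- exp (- \<i> * \<theta>)) *\<^sub>C cadjoint T v"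
    unfolding rotated_re_def scaleC_add_right scaleC_scaleC by simp
  also have "(- exp (- \<i> * \<theta>)) *\<^sub>C cadjoint T v = - (exp (- \<i> * \<theta>) *\<^sub>C cadjoint T v)"
    using scaleC_scaleC[of "- 1" "exp (- \<i> * \<theta>)" "cadjoint T v"] by (simp add: scaleC_minus1)
  finally show ?thesis by simp
qed

lemma onorm_rotated_diff:
  "onorm (\<lambda>v. exp (\<i> * \<theta>) *\<^sub>C T v - exp (- \<i> * \<theta>) *\<^sub>C cadjoint T v)
    = onorm (rotated_re T (\<theta> + pi / 2))"
  unfolding rotated_diff_eq onorm_def norm_scaleC by simp

text \<open>
  This is the operator identity \<open>H\<^sub>\<theta>\<^sup>2 + H\<^bsub>\<theta> + \<pi>/2\<^esub>\<^sup>2 = 2 (T T\<^sup>* + T\<^sup>* T)\<close> for the self-adjoint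
  \<open>H\<^sub>\<theta> = rotated_re T \<theta>\<close>, in the form of quadratic forms; it is the parallelogram law.
\<close>
lemma rotated_re_parallelogram:
  "(norm (rotated_re T \<theta> v))\<^sup>2 + (norm (rotated_re T (\<theta> + pi / 2) v))\<^sup>2
    = 2 * ((norm (T v))\<^sup>2 + (norm (cadjoint T v))\<^sup>2)"
proof -
  have "norm (rotated_re T (\<theta> + pi / 2) v)
      = norm (exp (\<i> * \<theta>) *\<^sub>C T v - exp (- \<i> * \<theta>) *\<^sub>C cadjoint T v)"
    unfolding rotated_diff_eq norm_scaleC by simp
  then show ?thesis
    using parallelogram_law[of "exp (\<i> * \<theta>) *\<^sub>C T v" "exp (- \<i> * \<theta>) *\<^sub>C cadjoint T v"]
    by (simp add: rotated_re_def norm_scaleC)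
qed

text \<open>
  \<open>T\<^sup>* T + T T\<^sup>*\<close> is self-adjoint, so a bound on its quadratic form, such as the one that
  \<open>rotated_re_parallelogram\<close> provides, is a bound on its norm.
\<close>
lemma onorm_modulus_sum_le:
  "2 * onorm (\<lambda>v. cadjoint T (T v) + T (cadjoint T v))
    \<le> (onorm (rotated_re T \<theta>))\<^sup>2 + (onorm (rotated_re T (\<theta> + pi / 2)))\<^sup>2"
proof -
  let ?P = "\<lambda>v. cadjoint T (T v) + T (cadjoint T v)"
  let ?c = "(onorm (rotated_re T \<theta>))\<^sup>2 + (onorm (rotated_re T (\<theta> + pi / 2)))\<^sup>2"
  note lin = bounded_clinear_bounded_linear[OF T]
    bounded_clinear_bounded_linear[OF bounded_clinear_cadjoint[OF T]]
  have "onorm ?P \<le> ?c / 2"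
  proof (rule onorm_symmetric_le)
    show "bounded_linear ?P"
      by (intro bounded_linear_add bounded_linear_compose[OF lin(1)]
        bounded_linear_compose[OF lin(2)] lin)
    show "inner (?P x) y = inner x (?P y)" for x y
      by (simp add: inner_eq_Re_cinner cinner_add_left cinner_add_right cinner_cadjoint'
        cinner_cadjoint[OF T])
    fix x
    have "inner (?P x) x = (norm (T x))\<^sup>2 + (norm (cadjoint T x))\<^sup>2"
      by (simp add: inner_eq_Re_cinner cinner_add_left cinner_cadjoint' cinner_cadjoint[OF T]
        cinner_self flip: of_real_power)
    then have "2 * \<bar>inner (?P x) x\<bar>
        = (norm (rotated_re T \<theta> x))\<^sup>2 + (norm (rotated_re T (\<theta> + pi / 2) x))\<^sup>2"
      by (simp add: rotated_re_parallelogram)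
    also have "\<dots> \<le> (onorm (rotated_re T \<theta>) * norm x)\<^sup>2
        + (onorm (rotated_re T (\<theta> + pi / 2)) * norm x)\<^sup>2"
      by (intro add_mono power_mono onorm bounded_linear_rotated_re norm_ge_zero)
    finally show "\<bar>inner (?P x) x\<bar> \<le> ?c / 2 * (norm x)\<^sup>2"
      by (simp add: power_mult_distrib algebra_simps)
  qed simp
  then show ?thesis by simp
qed

theorem numerical_radius_eq_iff:
  defines "N \<equiv> onorm (\<lambda>v. cadjoint T (T v) + T (cadjoint T v))"
  shows "(numerical_radius T)\<^sup>2 = 1 / 4 * N \<longleftrightarrow>
    (\<forall>\<theta>::real.
      (onorm (\<lambda>v. exp (\<i> * \<theta>) *\<^sub>C T v + exp (- \<i> * \<theta>) *\<^sub>C cadjoint T v))\<^sup>2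
        = (onorm (\<lambda>v. exp (\<i> * \<theta>) *\<^sub>C T v - exp (- \<i> * \<theta>) *\<^sub>C cadjoint T v))\<^sup>2
      \<and> (onorm (\<lambda>v. exp (\<i> * \<theta>) *\<^sub>C T v - exp (- \<i> * \<theta>) *\<^sub>C cadjoint T v))\<^sup>2 = N)"
    (is "?w \<longleftrightarrow> (\<forall>\<theta>. ?norms \<theta>)")
proof -
  define h where "h \<theta> = onorm (rotated_re T \<theta>)" for \<theta>
  have norms: "?norms \<theta> \<longleftrightarrow> (h \<theta>)\<^sup>2 = N \<and> (h (\<theta> + pi / 2))\<^sup>2 = N" for \<theta>
    unfolding h_def onorm_rotated_diff by (auto simp: rotated_re_def[abs_def])
  have h0: "0 \<le> h \<theta>" for \<theta>
    unfolding h_def by (rule onorm_pos_le[OF bounded_linear_rotated_re])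
  have h_le: "h \<theta> \<le> 2 * numerical_radius T" for \<theta>
    unfolding h_def by (rule onorm_rotated_re_le)
  show ?thesis
  proof
    assume ?w
    then have le: "(h \<theta>)\<^sup>2 \<le> N" for \<theta>
      using power_mono[OF h_le h0, of \<theta> 2] by (simp add: power_mult_distrib)
    \<comment> \<open>Two numbers that are at most \<open>N\<close> and add up to at least \<open>2 N\<close> both equal \<open>N\<close>.\<close>
    have "2 * N \<le> (h \<theta>)\<^sup>2 + (h (\<theta> + pi / 2))\<^sup>2" for \<theta>
      unfolding h_def N_def by (rule onorm_modulus_sum_le)
    then show "\<forall>\<theta>. ?norms \<theta>"
      unfolding norms using le by (smt (verit))
  next
    assume "\<forall>\<theta>. ?norms \<theta>"
    then have h: "h \<theta> = sqrt N" for \<theta>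
      unfolding norms using h0[of \<theta>] by (metis real_sqrt_unique)
    have "2 * numerical_radius T \<le> sqrt N"
      by (rule numerical_radius_le_onorm_rotated_re) (simp add: h flip: h_def)
    then have "2 * numerical_radius T = sqrt N" using h_le[of 0] h[of 0] by simp
    moreover have "0 \<le> N" using h0[of 0] h[of 0] by simp
    ultimately have "(2 * numerical_radius T)\<^sup>2 = N" by simp
    then show ?w by (simp add: power_mult_distrib)
  qed
qed

end

theorem proposition2p14:
  fixes A :: "'a::chilbert_space \<Rightarrow> 'a" and B :: "'b::chilbert_space \<Rightarrow> 'b"
  assumes "bounded_clinear A" and "bounded_clinear B"
  shows "(numerical_radius (A \<otimes>\<^sub>o B))\<^sup>2
        = 1 / 4 * onorm (\<lambda>v. ((cadjoint A \<circ> A) \<otimes>\<^sub>o (cadjoint B \<circ> B)) v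
                           + ((A \<circ> cadjoint A) \<otimes>\<^sub>o (B \<circ> cadjoint B)) v)
    \<longleftrightarrow>
    (\<forall>\<theta>::real.
      (onorm (\<lambda>v. exp (\<i> * \<theta>) *\<^sub>C (A \<otimes>\<^sub>o B) v
                + exp (- \<i> * \<theta>) *\<^sub>C (cadjoint A \<otimes>\<^sub>o cadjoint B) v))\<^sup>2
        = (onorm (\<lambda>v. exp (\<i> * \<theta>) *\<^sub>C (A \<otimes>\<^sub>o B) v
                    - exp (- \<i> * \<theta>) *\<^sub>C (cadjoint A \<otimes>\<^sub>o cadjoint B) v))\<^sup>2
      \<and>
      (onorm (\<lambda>v. exp (\<i> * \<theta>) *\<^sub>C (A \<otimes>\<^sub>o B) v
                - exp (- \<i> * \<theta>) *\<^sub>C (cadjoint A \<otimes>\<^sub>o cadjoint B) v))\<^sup>2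
        = onorm (\<lambda>v. ((cadjoint A \<circ> A) \<otimes>\<^sub>o (cadjoint B \<circ> B)) v
                   + ((A \<circ> cadjoint A) \<otimes>\<^sub>o (B \<circ> cadjoint B)) v))"
proof -
  note cA = bounded_clinear_cadjoint[OF assms(1)] and cB = bounded_clinear_cadjoint[OF assms(2)]
  show ?thesis
    using numerical_radius_eq_iff[OF bounded_clinear_tensor_op[OF assms]]
    by (simp only: tensor_op_compose cadjoint_tensor_op assms cA cB comp_apply)
qed

end
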